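(* Let $k\ge1$, let $f_1,\dots,f_k\in O(\mathbb{C}^{n-1})$ be entire functions, write points of $\mathbb{C}^n$ as $z=({}'z,z_n)$ with ${}'z\in\mathbb{C}^{n-1}$, $z_n\in\mathbb{C}$, and let $$A=\{({}'z,z_n)\in\mathbb{C}^n:\ F({}'z,z_n)=z_n^k+f_1({}'z)z_n^{k-1}+\dots+f_k({}'z)=0\}.$$ Then $X=\mathbb{C}^n\setminus A$ is $S^{*}$-parabolic.
   Context: Plurisubharmonic (psh) functions take values in $[-\infty,\infty)$ and are not identically $-\infty$; continuity means continuity as a map into $[-\infty,\infty)$. A function $\rho\in psh(X)$ on a complex manifold $X$ of dimension $n$ is an exhaustion if $\{z\in X:\rho(z)\le C\}$ is relatively compact in $X$ for every $C\in\mathbb{R}$. It is maximal on an open set $U$ if for every relatively compact open $G\subset\subset U$ and every $v\in psh(U)$ with $v\le\rho$ on $\partial G$ one has $v\le \rho$ on $G$ (where $\rho$ is locally bounded this is equivalent to $(dd^c\rho)^n=0$). A Stein manifold $X$ is $S^{*}$-parabolic if there is a continuous psh exhaustion function on $X$ that is maximal outside a compact subset of $X$. *)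

theory Defs
  imports "HOL-Analysis.Analysis"
begin

text \<open>Below, the sets \<open>U\<close>, \<open>X\<close> and \<open>D\<close> carrying functions are meant to be open.\<close>

definition holo_on :: "(complex ^ 'n \<Rightarrow> complex) \<Rightarrow> (complex ^ 'n) set \<Rightarrow> bool" where
  "holo_on f U \<longleftrightarrow>
     (\<forall>z\<in>U. \<exists>f'. (f has_derivative f') (at z) \<and> (\<forall>c v. f' (c *s v) = c * f' v))"

text \<open>
  The space $O(\mathbb{C}^{n-1})$ is encoded as the space of entire functions on $\mathbb{C}^n$ not
  depending on one coordinate \<open>l\<close>. This keeps the case $n = 1$, where there is no index type
  for $\mathbb{C}^0$.
\<close>

definition independent_of_coord :: "(complex ^ 'n \<Rightarrow> complex) \<Rightarrow> 'n \<Rightarrow> bool" where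
  "independent_of_coord f l \<longleftrightarrow> (\<forall>z w. (\<forall>i. i \<noteq> l \<longrightarrow> z $ i = w $ i) \<longrightarrow> f z = f w)"

text \<open>
  The quasi-integral $\int f^+ - \int f^-$; note that \<^const>\<open>e2ennreal\<close> sends negative arguments to 0.
  It is used only for functions bounded above on a space of finite measure, so the
  ill-defined case $\infty - \infty$ does not occur.
\<close>

definition ext_integral :: "'a measure \<Rightarrow> ('a \<Rightarrow> ereal) \<Rightarrow> ereal" where
  "ext_integral M f =
     enn2ereal (\<integral>\<^sup>+x. e2ennreal (f x) \<partial>M) - enn2ereal (\<integral>\<^sup>+x. e2ennreal (- f x) \<partial>M)"

definition circle_mean :: "(complex \<Rightarrow> ereal) \<Rightarrow> complex \<Rightarrow> real \<Rightarrow> ereal" where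
  "circle_mean u a r =
     ext_integral (uniform_measure lborel {0..2 * pi}) (\<lambda>t. u (a + of_real r * cis t))"

definition usc_on :: "'a::topological_space set \<Rightarrow> ('a \<Rightarrow> ereal) \<Rightarrow> bool" where
  "usc_on U u \<longleftrightarrow> (\<forall>c. openin (top_of_set U) {z \<in> U. u z < c})"

text \<open>
  Here the function may be identically $-\infty$, as happens for restrictions of
  plurisubharmonic functions to complex lines.
\<close>

definition subharmonic_on :: "complex set \<Rightarrow> (complex \<Rightarrow> ereal) \<Rightarrow> bool" where
  "subharmonic_on D u \<longleftrightarrow>
     (\<forall>z\<in>D. u z < \<infinity>) \<and> usc_on D u \<and>
     (\<forall>a r. 0 < r \<and> cball a r \<subseteq> D \<longrightarrow> u a \<le> circle_mean u a r)"

definition psh_on :: "(complex ^ 'n) set \<Rightarrow> (complex ^ 'n \<Rightarrow> ereal) \<Rightarrow> bool" where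
  "psh_on U u \<longleftrightarrow>
     (\<forall>z\<in>U. u z < \<infinity>) \<and> (\<exists>z\<in>U. u z \<noteq> -\<infinity>) \<and> usc_on U u \<and>
     (\<forall>a b. subharmonic_on {\<zeta>. a + \<zeta> *s b \<in> U} (\<lambda>\<zeta>. u (a + \<zeta> *s b)))"

definition rel_compact_in :: "'a::topological_space set \<Rightarrow> 'a set \<Rightarrow> bool" where
  "rel_compact_in G X \<longleftrightarrow> compact (closure G) \<and> closure G \<subseteq> X"

definition exhaustion_on :: "'a::topological_space set \<Rightarrow> ('a \<Rightarrow> ereal) \<Rightarrow> bool" where
  "exhaustion_on X \<rho> \<longleftrightarrow> (\<forall>C::real. rel_compact_in {z \<in> X. \<rho> z \<le> ereal C} X)"

definition maximal_on :: "(complex ^ 'n) set \<Rightarrow> (complex ^ 'n \<Rightarrow> ereal) \<Rightarrow> bool" where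
  "maximal_on U \<rho> \<longleftrightarrow>
     (\<forall>G v. open G \<and> rel_compact_in G U \<and> psh_on U v \<and> (\<forall>z\<in>frontier G. v z \<le> \<rho> z)
        \<longrightarrow> (\<forall>z\<in>G. v z \<le> \<rho> z))"

text \<open>
  The holomorphic hull of \<open>K\<close>; the condition on \<open>f\<close> says $|f(z)| \le \sup_K |f|$ (for compact \<open>K\<close>),
  phrased so that it also makes sense for empty \<open>K\<close>.
\<close>

definition holo_hull :: "(complex ^ 'n) set \<Rightarrow> (complex ^ 'n) set \<Rightarrow> (complex ^ 'n) set" where
  "holo_hull X K =
     {z \<in> X. \<forall>f M. holo_on f X \<and> (\<forall>w\<in>K. cmod (f w) \<le> M) \<longrightarrow> cmod (f z) \<le> M}"

text \<open>
  Stein manifolds among the open subsets of $\mathbb{C}^n$: holomorphically convex and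
  holomorphically separable. Global functions giving local coordinates at every point
  exist automatically here, namely the coordinate functions of $\mathbb{C}^n$.
\<close>

definition stein :: "(complex ^ 'n) set \<Rightarrow> bool" where
  "stein X \<longleftrightarrow>
     open X \<and>
     (\<forall>K. compact K \<and> K \<subseteq> X \<longrightarrow> compact (holo_hull X K)) \<and>
     (\<forall>z\<in>X. \<forall>w\<in>X. z \<noteq> w \<longrightarrow> (\<exists>f. holo_on f X \<and> f z \<noteq> f w))"

definition S_star_parabolic :: "(complex ^ 'n) set \<Rightarrow> bool" where
  "S_star_parabolic X \<longleftrightarrow>
     stein X \<and>
     (\<exists>\<rho>. psh_on X \<rho> \<and> continuous_on X \<rho> \<and> exhaustion_on X \<rho> \<and>
        (\<exists>K. compact K \<and> K \<subseteq> X \<and> maximal_on (X - K) \<rho>))"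

end

theory Submission
  imports Defs "HOL-Complex_Analysis.Conformal_Mappings"
begin

text \<open>
  The exhaustion function is $\rho = \ln V$ with $V = (|{}'z|^2 + |F - 1|^2) / |F|$, and the exceptional
  compact set is $\{{}'z = 0, F = 1\}$, where $\rho = -\infty$. It is plurisubharmonic because $\ln |F|$ is
  pluriharmonic off $A$, and an exhaustion because $({}'z, F)$ is a proper map.

  For the mean value inequality on a circle, a continuous majorant of $\rho$ is approximated there by the
  real part of a polynomial $P$, and the maximum principle is applied to
  $\langle g, g(a)\rangle^2 e^{-P} / F$, where $g = ({}'z, F - 1)$.

  For maximality, suppose that $v \le \rho$ on $\partial G$ fails to persist in $G$. Then
  $v - \rho + \epsilon |z|^2$ has an interior maximum $p$. The Levi form of $\rho$ at $p$ has a null direction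
  $b$, tangent to the fibre of $[g]$ into projective space, so up to an error $o(|\zeta|^2)$ the function
  $v(p + \zeta b)$ is dominated by a harmonic function minus $\epsilon |b|^2 |\zeta|^2$, with equality at
  $\zeta = 0$. This contradicts the mean value inequality for $v$ on the line.
\<close>

subsection \<open>Means over circles\<close>

abbreviation circle_measure :: "real measure" where
  "circle_measure \<equiv> uniform_measure lborel {0..2 * pi}"

lemma finite_circle_measure: "finite_measure circle_measure"
  by (rule finite_measureI) (simp add: emeasure_lborel_Icc_eq)

text \<open>Passes to the gauge integral, the form in which Cauchy's integral formula for a
  parametrised circle delivers its value.\<close>

lemma integral_circle_measure:
  fixes f :: "real \<Rightarrow> 'a::euclidean_space"
  assumes "continuous_on UNIV f"
  shows "integral\<^sup>L circle_measure f = (1 / (2 * pi)) *\<^sub>R integral {0..2 * pi} f"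
proof -
  have eq: "circle_measure = density lborel (\<lambda>x. ennreal (indicator {0..2*pi} x / (2 * pi)))"
    unfolding uniform_measure_def
    by (intro density_cong) (auto simp: indicator_def divide_ennreal simp flip: ennreal_1)
  have meas: "f \<in> borel_measurable lborel"
    using borel_measurable_continuous_onI[OF assms] by simp
  have "integral\<^sup>L circle_measure f
        = integral\<^sup>L lborel (\<lambda>x. (indicator {0..2*pi} x / (2 * pi)) *\<^sub>R f x)"
    unfolding eq by (rule integral_density) (use meas in auto)
  also have "\<dots> = integral\<^sup>L lborel (\<lambda>x. (1 / (2 * pi)) *\<^sub>R (indicator {0..2*pi} x *\<^sub>R f x))"
    by (rule Bochner_Integration.integral_cong) simp_all
  also have "\<dots> = (1 / (2 * pi)) *\<^sub>R (LINT x:{0..2*pi}|lborel. f x)"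
    unfolding set_lebesgue_integral_def by (rule integral_scaleR_right)
  also have "(LINT x:{0..2*pi}|lborel. f x) = integral {0..2 * pi} f"
    by (rule set_borel_integral_eq_integral, rule borel_integrable_atLeastAtMost')
       (rule continuous_on_subset[OF assms], simp)
  finally show ?thesis .
qed

lemma integrable_circle_measure:
  fixes f :: "complex \<Rightarrow> real"
  assumes "continuous_on (sphere a r) f" "0 \<le> r"
  shows "integrable circle_measure (\<lambda>t. f (a + of_real r * cis t))"
proof -
  have sph: "a + of_real r * cis t \<in> sphere a r" for t
    using assms(2) by (simp add: dist_norm norm_mult)
  have "compact (f ` sphere a r)"
    by (rule compact_continuous_image[OF assms(1)]) simp
  then obtain B where B: "\<And>z. z \<in> sphere a r \<Longrightarrow> norm (f z) \<le> B"
    by (meson bounded_iff compact_imp_bounded imageI)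
  have "continuous_on UNIV (\<lambda>t. f (a + of_real r * cis t))"
    by (rule continuous_on_compose2[OF assms(1)])
       (use sph in \<open>auto intro!: continuous_intros simp: cis_conv_exp\<close>)
  then have "(\<lambda>t. f (a + of_real r * cis t)) \<in> borel_measurable circle_measure"
    using borel_measurable_continuous_onI by (auto simp: measurable_def)
  then show ?thesis
    by (rule finite_measure.integrable_const_bound[OF finite_circle_measure, of _ B, rotated])
       (use B sph in \<open>auto intro!: AE_I2\<close>)
qed

text \<open>Cauchy's integral formula in the angular parameter: on the circle
  \<open>dz / (z - a)\<close> equals \<open>\<i> dt\<close>, so the formula turns into the mean of
  \<open>f\<close>.\<close>

lemma mean_value_circle:
  assumes "continuous_on (cball a r) f" "f holomorphic_on ball a r" "0 < r"
  shows "integral\<^sup>L circle_measure (\<lambda>t. Re (f (a + of_real r * cis t))) = Re (f a)"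
proof -
  have sph: "a + of_real r * cis t \<in> cball a r" for t
    using assms(3) by (simp add: dist_norm norm_mult)
  have cont: "continuous_on UNIV (\<lambda>t. f (a + of_real r * cis t))"
    by (rule continuous_on_compose2[OF assms(1)])
       (use sph in \<open>auto intro!: continuous_intros simp: cis_conv_exp\<close>)
  have "((\<lambda>u. f u / (u - a)) has_contour_integral (2 * of_real pi * \<i> * f a)) (circlepath a r)"
    by (rule Cauchy_integral_circlepath) (use assms in auto)
  then have "((\<lambda>t. f (a + r * cis t) / (a + r * cis t - a) * r * \<i> * cis t) has_integral
       (2 * of_real pi * \<i> * f a)) {0..2*pi}"
    unfolding circlepath_def by (subst (asm) has_contour_integral_part_circlepath_iff) auto
  moreover have "f (a + r * cis t) / (a + r * cis t - a) * r * \<i> * cis t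
      = \<i> * f (a + r * cis t)" for t
    using assms(3) by (simp add: field_simps)
  ultimately have "((\<lambda>t. \<i> * f (a + r * cis t)) has_integral (2 * of_real pi * \<i> * f a)) {0..2*pi}"
    by (simp only:)
  then have "((\<lambda>t. - \<i> * (\<i> * f (a + r * cis t))) has_integral
       - \<i> * (2 * of_real pi * \<i> * f a)) {0..2*pi}"
    by (rule has_integral_mult_right)
  then have "((\<lambda>t. f (a + r * cis t)) has_integral (2 * of_real pi * f a)) {0..2*pi}"
    by (simp add: algebra_simps)
  from has_integral_linear[OF this bounded_linear_Re]
  have "((\<lambda>t. Re (f (a + r * cis t))) has_integral (2 * pi * Re (f a))) {0..2*pi}"
    by (simp add: o_def)
  moreover have "continuous_on UNIV (\<lambda>t. Re (f (a + of_real r * cis t)))"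
    by (intro continuous_intros cont)
  ultimately show ?thesis
    by (simp add: integral_circle_measure integral_unique)
qed

text \<open>The nonnegative integral is monotone for arbitrary functions, so a plurisubharmonic
  function on a circle can be compared with a majorant without any measurability argument.\<close>

lemma ext_integral_mono:
  assumes "\<And>x. f x \<le> g x"
  shows "ext_integral M f \<le> ext_integral M g"
  unfolding ext_integral_def
  by (intro ereal_minus_mono less_eq_ennreal.rep_eq[THEN iffD1] nn_integral_mono e2ennreal_mono)
     (use assms in auto)

lemma ext_integral_ereal:
  assumes "integrable M f"
  shows "ext_integral M (\<lambda>x. ereal (f x)) = ereal (integral\<^sup>L M f)"
proof -
  obtain p where p: "(\<integral>\<^sup>+x. ennreal (f x) \<partial>M) = ennreal p" "0 \<le> p"
    using assms by (cases "\<integral>\<^sup>+x. ennreal (f x) \<partial>M") (auto simp: real_integrable_def)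
  obtain q where q: "(\<integral>\<^sup>+x. ennreal (- f x) \<partial>M) = ennreal q" "0 \<le> q"
    using assms by (cases "\<integral>\<^sup>+x. ennreal (- f x) \<partial>M") (auto simp: real_integrable_def)
  show ?thesis
    using p q unfolding ext_integral_def real_lebesgue_integral_def[OF assms]
    by simp
qed

lemma circle_mean_ereal:
  assumes "continuous_on (sphere a r) f" "0 \<le> r"
  shows "circle_mean (\<lambda>z. ereal (f z)) a r
         = ereal (integral\<^sup>L circle_measure (\<lambda>t. f (a + of_real r * cis t)))"
  unfolding circle_mean_def
  by (rule ext_integral_ereal) (rule integrable_circle_measure[OF assms])

lemma circle_mean_mono:
  assumes "\<And>z. z \<in> sphere a r \<Longrightarrow> u z \<le> v z" "0 \<le> r"
  shows "circle_mean u a r \<le> circle_mean v a r"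
  unfolding circle_mean_def
  by (rule ext_integral_mono) (use assms in \<open>simp add: dist_norm norm_mult\<close>)

subsection \<open>The mean value inequality\<close>

text \<open>On the unit circle the conjugate of \<open>\<zeta>\<close> is
  \<open>1 / \<zeta>\<close>, so real and imaginary part are Laurent polynomials in
  \<open>\<zeta>\<close>; quotients of a polynomial by a power of \<open>\<zeta>\<close> are stable
  under sums and products.\<close>

lemma real_polynomial_function_on_circle:
  fixes g :: "complex \<Rightarrow> real"
  assumes "real_polynomial_function g"
  shows "\<exists>p N. \<forall>\<zeta>. cmod \<zeta> = 1 \<longrightarrow> of_real (g (a + of_real r * \<zeta>)) = poly p \<zeta> / \<zeta> ^ N"
  using assms
proof induction
  case (linear f)
  \<comment> \<open>Obtained from \<open>f a + r * (Re \<zeta> * f 1 + Im \<zeta> * f \<i>)\<close>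
    by expressing \<open>Re \<zeta>\<close> and \<open>Im \<zeta>\<close> through
    \<open>\<zeta>\<close> and \<open>1 / \<zeta>\<close> and multiplying by
    \<open>\<zeta>\<close>.\<close>
  let ?p = "[: of_real (r * f 1) / 2 - of_real (r * f \<i>) / (2 * \<i>), of_real (f a),
               of_real (r * f 1) / 2 + of_real (r * f \<i>) / (2 * \<i>) :]"
  have "of_real (f (a + of_real r * \<zeta>)) = poly ?p \<zeta> / \<zeta> ^ 1" if "cmod \<zeta> = 1" for \<zeta>
  proof -
    have nz: "\<zeta> \<noteq> 0" using that by auto
    have cnj: "cnj \<zeta> = 1 / \<zeta>"
      using that nz complex_norm_square[of \<zeta>] by (simp add: field_simps)
    have Re: "of_real (Re \<zeta>) = (\<zeta> + 1 / \<zeta>) / 2"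
      using complex_add_cnj[of \<zeta>] by (simp add: cnj)
    have Im: "of_real (Im \<zeta>) = (\<zeta> - 1 / \<zeta>) / (2 * \<i>)"
      using complex_diff_cnj[of \<zeta>] by (simp add: cnj field_simps)
    interpret f: bounded_linear f by fact
    have "a + of_real r * \<zeta> = a + r *\<^sub>R (Re \<zeta> *\<^sub>R 1 + Im \<zeta> *\<^sub>R \<i>)"
      by (simp add: complex_eq_iff)
    then have "f (a + of_real r * \<zeta>) = f a + r * (Re \<zeta> * f 1 + Im \<zeta> * f \<i>)"
      by (simp add: f.add f.scaleR)
    then have "complex_of_real (f (a + of_real r * \<zeta>)) =
       of_real (f a) + of_real r * ((\<zeta> + 1 / \<zeta>) / 2 * of_real (f 1)
         + (\<zeta> - 1 / \<zeta>) / (2 * \<i>) * of_real (f \<i>))"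
      by (simp only: of_real_add of_real_mult Re Im)
    also have "\<dots> = poly ?p \<zeta> / \<zeta> ^ 1"
      using nz by (simp add: field_simps)
    finally show ?thesis .
  qed
  then show ?case by blast
next
  case (const c)
  show ?case by (rule exI[of _ "[:of_real c:]"], rule exI[of _ 0]) simp
next
  case (add f g)
  then obtain p N q M where
    "\<And>\<zeta>. cmod \<zeta> = 1 \<Longrightarrow> of_real (f (a + of_real r * \<zeta>)) = poly p \<zeta> / \<zeta> ^ N"
    "\<And>\<zeta>. cmod \<zeta> = 1 \<Longrightarrow> of_real (g (a + of_real r * \<zeta>)) = poly q \<zeta> / \<zeta> ^ M"
    by metis
  then have "of_real (f (a + of_real r * \<zeta>) + g (a + of_real r * \<zeta>))
       = poly (p * monom 1 M + q * monom 1 N) \<zeta> / \<zeta> ^ (N + M)" if "cmod \<zeta> = 1" for \<zeta>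
    using that by (cases "\<zeta> = 0") (auto simp: poly_monom power_add field_simps)
  then show ?case by blast
next
  case (mult f g)
  then obtain p N q M where
    "\<And>\<zeta>. cmod \<zeta> = 1 \<Longrightarrow> of_real (f (a + of_real r * \<zeta>)) = poly p \<zeta> / \<zeta> ^ N"
    "\<And>\<zeta>. cmod \<zeta> = 1 \<Longrightarrow> of_real (g (a + of_real r * \<zeta>)) = poly q \<zeta> / \<zeta> ^ M"
    by metis
  then have "of_real (f (a + of_real r * \<zeta>) * g (a + of_real r * \<zeta>))
       = poly (p * q) \<zeta> / \<zeta> ^ (N + M)" if "cmod \<zeta> = 1" for \<zeta>
    using that by (simp add: power_add)
  then show ?case by blast
qed

text \<open>A term \<open>c / \<zeta> ^ m\<close> and its conjugate
  \<open>cnj c * \<zeta> ^ m\<close> have the same real part on the unit circle. The induction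
  reflects the most negative power in this way and lowers \<open>N\<close> by one.\<close>

lemma Re_laurent_on_circle:
  "\<exists>q. \<forall>\<zeta>. cmod \<zeta> = 1 \<longrightarrow> Re (poly p \<zeta> / \<zeta> ^ N) = Re (poly q \<zeta>)"
proof (induction N arbitrary: p)
  case 0
  show ?case by auto
next
  case (Suc N)
  obtain c p' where p: "p = pCons c p'" by (cases p)
  obtain q where q: "\<And>\<zeta>. cmod \<zeta> = 1 \<Longrightarrow> Re (poly p' \<zeta> / \<zeta> ^ N) = Re (poly q \<zeta>)"
    using Suc by blast
  have "Re (poly p \<zeta> / \<zeta> ^ Suc N) = Re (poly (monom (cnj c) (Suc N) + q) \<zeta>)"
    if \<zeta>: "cmod \<zeta> = 1" for \<zeta>
  proof -
    have nz: "\<zeta> \<noteq> 0" using \<zeta> by auto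
    have "cnj (c / \<zeta> ^ Suc N) = cnj c * \<zeta> ^ Suc N"
      using \<zeta> nz complex_norm_square[of \<zeta>]
      by (simp add: power_mult_distrib[symmetric] field_simps del: power_Suc)
    then have "Re (c / \<zeta> ^ Suc N) = Re (cnj c * \<zeta> ^ Suc N)"
      using cnj.sel(1)[of "c / \<zeta> ^ Suc N"] by simp
    moreover have "poly p \<zeta> / \<zeta> ^ Suc N = c / \<zeta> ^ Suc N + poly p' \<zeta> / \<zeta> ^ N"
      using nz by (simp add: p field_simps)
    ultimately show ?thesis
      using q[OF \<zeta>] by (simp add: poly_monom del: power_Suc)
  qed
  then show ?case by blast
qed

text \<open>Stone-Weierstrass followed by the two reductions above. The real part of
  \<open>P\<close> stands in for the solution of the Dirichlet problem with boundary values
  \<phi>.\<close>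

lemma approx_circle_by_Re_holomorphic:
  fixes \<phi> :: "complex \<Rightarrow> real"
  assumes "continuous_on (sphere a r) \<phi>" "0 < r" "0 < e"
  obtains P where "P holomorphic_on UNIV" "\<And>z. z \<in> sphere a r \<Longrightarrow> \<bar>\<phi> z - Re (P z)\<bar> < e"
proof -
  obtain g where g: "real_polynomial_function g" "\<And>z. z \<in> sphere a r \<Longrightarrow> \<bar>\<phi> z - g z\<bar> < e"
    using Stone_Weierstrass_real_polynomial_function[of "sphere a r" \<phi> e] assms by auto
  obtain p N where pN:
    "\<And>\<zeta>. cmod \<zeta> = 1 \<Longrightarrow> of_real (g (a + of_real r * \<zeta>)) = poly p \<zeta> / \<zeta> ^ N"
    using real_polynomial_function_on_circle[OF g(1)] by metis
  obtain q where q: "\<And>\<zeta>. cmod \<zeta> = 1 \<Longrightarrow> Re (poly p \<zeta> / \<zeta> ^ N) = Re (poly q \<zeta>)"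
    using Re_laurent_on_circle by metis
  show ?thesis
  proof
    show "(\<lambda>z. poly q ((z - a) / of_real r)) holomorphic_on UNIV"
      using assms by (intro holomorphic_intros) auto
    fix z assume z: "z \<in> sphere a r"
    define \<zeta> where "\<zeta> = (z - a) / of_real r"
    have \<zeta>: "cmod \<zeta> = 1" "z = a + of_real r * \<zeta>"
      using z assms by (auto simp: \<zeta>_def dist_norm norm_divide norm_minus_commute)
    then have "g z = Re (poly q \<zeta>)"
      using pN q by (metis Re_complex_of_real)
    then show "\<bar>\<phi> z - Re (poly q ((z - a) / of_real r))\<bar> < e"
      using g(2)[OF z] by (simp add: \<zeta>_def)
  qed
qed

section \<open>Sub-mean value inequality for sums of squared moduli\<close>

lemma ln_le_iff_le_exp: "0 < x \<Longrightarrow> ln x \<le> c \<longleftrightarrow> x \<le> exp c" for x c :: real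
  by (metis exp_le_cancel_iff exp_ln)

text \<open>Pairing the vector of the \<open>g i\<close> with its value at \<open>a\<close> gives
  one holomorphic function, to which the maximum modulus principle applies; Cauchy-Schwarz bounds it
  on the circle and is an equality at \<open>a\<close>. The exponentiated form covers the case where
  all \<open>g i\<close> vanish at \<open>a\<close>.\<close>

lemma sub_mean_value_exp:
  fixes g :: "'i \<Rightarrow> complex \<Rightarrow> complex"
  assumes g: "\<And>i. i \<in> I \<Longrightarrow> g i holomorphic_on D"
    and h: "h holomorphic_on D" "\<And>z. z \<in> D \<Longrightarrow> h z \<noteq> 0"
    and D: "cball a r \<subseteq> D" "0 < r"
    and \<phi>: "continuous_on (sphere a r) \<phi>"
    and le: "\<And>z. z \<in> sphere a r \<Longrightarrow> (\<Sum>i\<in>I. (cmod (g i z))\<^sup>2) / cmod (h z) \<le> exp (\<phi> z)"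
  shows "(\<Sum>i\<in>I. (cmod (g i a))\<^sup>2) / cmod (h a)
         \<le> exp (integral\<^sup>L circle_measure (\<lambda>t. \<phi> (a + of_real r * cis t)))"
proof -
  define s where "s = (\<Sum>i\<in>I. (cmod (g i a))\<^sup>2)"
  let ?m = "integral\<^sup>L circle_measure (\<lambda>t. \<phi> (a + of_real r * cis t))"
  have "s \<ge> 0" unfolding s_def by (intro sum_nonneg) auto
  show ?thesis
  proof (cases "s = 0")
    case True
    then show ?thesis by (simp flip: s_def)
  next
    case False
    then have s: "s > 0" using \<open>s \<ge> 0\<close> by simp
    have aD: "a \<in> D" using D by auto
    have ha: "cmod (h a) > 0" using h(2)[OF aD] by simp
    \<comment> \<open>One half of \<open>e\<close> is spent in bounding \<psi> on the circle, the
      other half in returning from the mean of \<open>Re P\<close> to the mean of \<phi>.\<close>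
    have "ln (s / cmod (h a)) \<le> ?m + e" if "e > 0" for e
    proof -
      obtain P where P: "P holomorphic_on UNIV"
        and near: "\<And>z. z \<in> sphere a r \<Longrightarrow> \<bar>\<phi> z - Re (P z)\<bar> < e / 2"
        using approx_circle_by_Re_holomorphic[OF \<phi> D(2), of "e / 2"] \<open>e > 0\<close> by auto
      have PD: "P holomorphic_on D" using P by (rule holomorphic_on_subset) simp
      define \<psi> where "\<psi> z = (\<Sum>i\<in>I. cnj (g i a) * g i z)\<^sup>2 / h z * exp (- P z)" for z
      have \<psi>: "\<psi> holomorphic_on D"
        unfolding \<psi>_def using g h PD by (intro holomorphic_intros) auto
      have cont: "continuous_on (cball a r) \<psi>"
        using \<psi> D by (meson continuous_on_subset holomorphic_on_imp_continuous_on)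
      have hol: "\<psi> holomorphic_on ball a r"
        using \<psi> D by (meson ball_subset_cball holomorphic_on_subset order_trans)
      have "cmod (\<psi> a) \<le> s * exp (e / 2)"
      proof (rule maximum_modulus_frontier[of \<psi> "cball a r" _ a])
        fix z assume "z \<in> frontier (cball a r)"
        then have z: "z \<in> sphere a r" by simp
        then have hz: "cmod (h z) > 0" using h(2)[of z] D by auto
        have "cmod (\<Sum>i\<in>I. cnj (g i a) * g i z) \<le> (\<Sum>i\<in>I. cmod (g i a) * cmod (g i z))"
          by (rule order_trans[OF norm_sum]) (simp add: norm_mult)
        then have "(cmod (\<Sum>i\<in>I. cnj (g i a) * g i z))\<^sup>2 \<le> (\<Sum>i\<in>I. cmod (g i a) * cmod (g i z))\<^sup>2"
          by (rule power_mono) simp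
        also have "\<dots> \<le> s * (\<Sum>i\<in>I. (cmod (g i z))\<^sup>2)"
          unfolding s_def by (rule Cauchy_Schwarz_ineq_sum)
        finally have "cmod (\<psi> z) \<le> s * (\<Sum>i\<in>I. (cmod (g i z))\<^sup>2) / cmod (h z) * exp (- Re (P z))"
          unfolding \<psi>_def norm_mult norm_divide norm_power norm_exp_eq_Re
          using hz by (simp add: divide_right_mono)
        also have "\<dots> = s * ((\<Sum>i\<in>I. (cmod (g i z))\<^sup>2) / cmod (h z)) * exp (- Re (P z))"
          by simp
        also have "\<dots> \<le> s * exp (\<phi> z) * exp (- Re (P z))"
          using le[OF z] s by (intro mult_right_mono mult_left_mono) auto
        also have "\<dots> = s * exp (\<phi> z - Re (P z))"
          by (simp add: exp_diff exp_minus field_simps)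
        also have "\<dots> \<le> s * exp (e / 2)"
        proof -
          have "\<phi> z - Re (P z) \<le> e / 2" using near[OF z] by linarith
          then show ?thesis using s by simp
        qed
        finally show "cmod (\<psi> z) \<le> s * exp (e / 2)" .
      qed (use cont hol D in auto)
      moreover have "cmod (\<psi> a) = s * (s / cmod (h a)) * exp (- Re (P a))"
      proof -
        have "(\<Sum>i\<in>I. cnj (g i a) * g i a) = of_real s"
          unfolding s_def of_real_sum
          by (intro sum.cong refl) (metis complex_norm_square mult.commute)
        then show ?thesis
          using s by (simp add: \<psi>_def norm_mult norm_divide norm_power norm_exp_eq_Re power2_eq_square)
      qed
      \<comment> \<open>The value at \<open>a\<close> carries \<open>s\<close> twice and the bound
        from the circle only once, so cancelling one factor leaves the quotient in question.\<close>
      ultimately have "s * (s / cmod (h a) * exp (- Re (P a))) \<le> s * exp (e / 2)"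
        by (simp only: mult.assoc)
      then have "s / cmod (h a) * exp (- Re (P a)) \<le> exp (e / 2)"
        using s by (simp only: mult_le_cancel_left_pos)
      then have "s / cmod (h a) * exp (- Re (P a)) * exp (Re (P a)) \<le> exp (e / 2) * exp (Re (P a))"
        by (rule mult_right_mono) simp
      then have "s / cmod (h a) \<le> exp (Re (P a) + e / 2)"
        by (simp add: mult.assoc mult_exp_exp add.commute)
      then have "ln (s / cmod (h a)) \<le> Re (P a) + e / 2"
        using s ha by (simp add: ln_le_iff_le_exp flip: ln_div)
      also have "Re (P a) = integral\<^sup>L circle_measure (\<lambda>t. Re (P (a + of_real r * cis t)))"
        by (rule mean_value_circle[symmetric])
           (use P D(2) in \<open>auto intro: holomorphic_on_imp_continuous_on holomorphic_on_subset\<close>)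
      also have "\<dots> \<le> integral\<^sup>L circle_measure (\<lambda>t. \<phi> (a + of_real r * cis t) + e / 2)"
      proof (rule integral_mono)
        show "integrable circle_measure (\<lambda>t. Re (P (a + of_real r * cis t)))"
          by (rule integrable_circle_measure)
             (use P D(2) in \<open>auto intro!: continuous_intros
                intro: holomorphic_on_imp_continuous_on holomorphic_on_subset\<close>)
        show "integrable circle_measure (\<lambda>t. \<phi> (a + of_real r * cis t) + e / 2)"
          by (rule integrable_circle_measure[where f = "\<lambda>z. \<phi> z + e / 2"])
             (use \<phi> D(2) in \<open>auto intro!: continuous_intros\<close>)
        fix t
        have "a + of_real r * cis t \<in> sphere a r"
          using D(2) by (simp add: dist_norm norm_mult)
        from near[OF this] show "Re (P (a + of_real r * cis t)) \<le> \<phi> (a + of_real r * cis t) + e / 2"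
          by linarith
      qed
      also have "\<dots> = ?m + e / 2"
      proof -
        interpret prob: finite_measure circle_measure by (rule finite_circle_measure)
        have "measure circle_measure UNIV = 1"
          by (subst measure_uniform_measure) auto
        then show ?thesis
          using integrable_circle_measure[OF \<phi>] D(2) by (subst Bochner_Integration.integral_add) auto
      qed
      finally show ?thesis by simp
    qed
    then have "ln (s / cmod (h a)) \<le> ?m" by (rule field_le_epsilon)
    then show ?thesis
      using s ha by (simp add: ln_le_iff_le_exp flip: s_def ln_div)
  qed
qed

section \<open>The logarithm with values in the extended reals\<close>

definition log_ereal :: "real \<Rightarrow> ereal" where
  "log_ereal x = (if x \<le> 0 then -\<infinity> else ereal (ln x))"

lemma log_ereal_neq_PInf [simp]: "log_ereal x \<noteq> \<infinity>"
  by (simp add: log_ereal_def)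

lemma log_ereal_eq_MInf_iff: "log_ereal x = -\<infinity> \<longleftrightarrow> x \<le> 0"
  by (simp add: log_ereal_def)

lemma log_ereal_le_iff: "log_ereal x \<le> ereal c \<longleftrightarrow> x \<le> exp c"
  using exp_gt_zero[of c] by (auto simp: log_ereal_def ln_le_iff_le_exp intro: order_trans less_imp_le)

lemma log_ereal_less_iff: "log_ereal x < ereal c \<longleftrightarrow> x < exp c"
proof (cases "x \<le> 0")
  case False
  then have "ln x < c \<longleftrightarrow> x < exp c" by (metis exp_less_cancel_iff exp_ln not_le)
  with False show ?thesis by (simp add: log_ereal_def)
qed (use exp_gt_zero[of c] in \<open>auto simp: log_ereal_def intro: le_less_trans\<close>)

text \<open>Lower bounds have to be checked only at positive points, where \<open>ln\<close> is
  continuous; upper bounds are governed by \<open>log_ereal_less_iff\<close> everywhere.\<close>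

lemma continuous_on_log_ereal: "continuous_on UNIV log_ereal"
proof (clarsimp simp: continuous_on_eq_continuous_at continuous_at)
  fix x
  show "(log_ereal \<longlongrightarrow> log_ereal x) (at x)"
  proof (rule order_tendstoI)
    fix c assume "c < log_ereal x"
    then have x: "x > 0" "c < ereal (ln x)" by (auto simp: log_ereal_def split: if_splits)
    have "((\<lambda>y. ereal (ln y)) \<longlongrightarrow> ereal (ln x)) (at x)"
      using x by (intro tendsto_intros) auto
    then have "eventually (\<lambda>y. c < ereal (ln y)) (at x)"
      using x(2) order_tendstoD(1) by blast
    moreover have "eventually (\<lambda>y. 0 < y) (at x)"
      using x(1) order_tendstoD(1)[OF tendsto_ident_at] by blast
    ultimately show "eventually (\<lambda>y. c < log_ereal y) (at x)"
      by eventually_elim (simp add: log_ereal_def)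
  next
    fix c assume c: "log_ereal x < c"
    then obtain d where d: "log_ereal x < ereal d" "ereal d < c"
      using ereal_dense2 by blast
    have "eventually (\<lambda>y. y < exp d) (at x)"
      using d(1) order_tendstoD(2)[OF tendsto_ident_at] by (auto simp: log_ereal_less_iff)
    then show "eventually (\<lambda>y. log_ereal y < c) (at x)"
      by eventually_elim (use d(2) log_ereal_less_iff in \<open>blast intro: less_trans\<close>)
  qed
qed

text \<open>The truncations \<open>max V (exp (- N))\<close> leave the positive part of \<open>log_ereal V\<close> unchanged,
  and their negative parts increase to that of \<open>log_ereal V\<close>.\<close>

lemma le_circle_mean_log_ereal:
  assumes V: "continuous_on (sphere a r) V" and r: "0 \<le> r"
    and le: "\<And>N::nat. ereal x \<le> circle_mean (\<lambda>z. ereal (ln (max (V z) (exp (- real N))))) a r"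
  shows "ereal x \<le> circle_mean (\<lambda>z. log_ereal (V z)) a r"
proof -
  define W where "W t = V (a + of_real r * cis t)" for t
  define \<phi> where "\<phi> N t = ln (max (W t) (exp (- real N)))" for N t
  have max_exp_pos: "0 < max y (exp c)" for y c :: real
    by (simp add: less_max_iff_disj)
  have int: "integrable circle_measure (\<phi> N)" for N
    unfolding \<phi>_def W_def
    by (rule integrable_circle_measure[where f = "\<lambda>z. ln (max (V z) (exp (- real N)))"])
       (use V r max_exp_pos in \<open>auto intro!: continuous_intros simp: less_imp_neq[symmetric]\<close>)
  define A where "A = (\<integral>\<^sup>+t. ennreal (\<phi> 0 t) \<partial>circle_measure)"
  define B where "B N = (\<integral>\<^sup>+t. ennreal (- \<phi> N t) \<partial>circle_measure)" for N
  have pos: "e2ennreal (log_ereal (W t)) = ennreal (\<phi> N t)" for N t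
  proof (cases "W t \<le> 1")
    case True
    then have "log_ereal (W t) \<le> 0"
      using log_ereal_le_iff[of _ 0] by (simp add: zero_ereal_def)
    moreover have "\<phi> N t \<le> 0"
      using True ln_le_zero_iff[OF max_exp_pos] by (simp add: \<phi>_def)
    ultimately show ?thesis by (simp add: e2ennreal_neg ennreal_neg)
  next
    case False
    then have "exp (- real N) \<le> W t"
      by (meson exp_le_one_iff le_cases neg_le_0_iff_le of_nat_0_le_iff order_trans)
    then show ?thesis using False by (simp add: \<phi>_def log_ereal_def max_def)
  qed
  have neg: "(SUP N. ennreal (- \<phi> N t)) = e2ennreal (- log_ereal (W t))" for t
  proof (cases "W t \<le> 0")
    case True
    then have "\<phi> N t = - real N" for N
      by (simp add: \<phi>_def max_absorb2 order_trans[of _ 0])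
    then show ?thesis
      using True ennreal_SUP_of_nat_eq_top
      by (simp add: log_ereal_def ennreal_of_nat_eq_real_of_nat)
  next
    case False
    show ?thesis
    proof (rule SUP_eqI)
      fix N
      have "ln (W t) \<le> \<phi> N t" using False by (simp add: \<phi>_def)
      then show "ennreal (- \<phi> N t) \<le> e2ennreal (- log_ereal (W t))"
        using False by (simp add: log_ereal_def ennreal_leI)
    next
      fix y assume y: "\<And>N. N \<in> UNIV \<Longrightarrow> ennreal (- \<phi> N t) \<le> y"
      obtain N :: nat where "- ln (W t) \<le> real N" using real_arch_simple by blast
      then have "exp (- real N) \<le> W t"
        using False by (metis exp_le_cancel_iff exp_ln minus_le_iff not_le)
      then have "\<phi> N t = ln (W t)" by (simp add: \<phi>_def max_def)
      then show "e2ennreal (- log_ereal (W t)) \<le> y"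
        using y[of N] False by (simp add: log_ereal_def)
    qed
  qed
  have mean: "circle_mean (\<lambda>z. log_ereal (V z)) a r = enn2ereal A - enn2ereal (SUP N. B N)"
  proof -
    have "(\<integral>\<^sup>+t. e2ennreal (- log_ereal (W t)) \<partial>circle_measure)
          = (\<integral>\<^sup>+t. (SUP N. ennreal (- \<phi> N t)) \<partial>circle_measure)"
      by (simp add: neg)
    also have "\<dots> = (SUP N. B N)"
      unfolding B_def
    proof (rule nn_integral_monotone_convergence_SUP)
      show "incseq (\<lambda>N t. ennreal (- \<phi> N t))"
      proof (rule incseq_SucI, rule le_funI)
        fix N t
        have "max (W t) (exp (- real (Suc N))) \<le> max (W t) (exp (- real N))"
          by (rule max.mono) auto
        then show "ennreal (- \<phi> N t) \<le> ennreal (- \<phi> (Suc N) t)"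
          unfolding \<phi>_def using max_exp_pos by (intro ennreal_leI) (simp only: neg_le_iff_le ln_le_cancel_iff)
      qed
      show "(\<lambda>t. ennreal (- \<phi> N t)) \<in> borel_measurable circle_measure" for N
        using int[of N] by measurable
    qed
    finally show ?thesis
      unfolding circle_mean_def ext_integral_def A_def
      by (simp add: pos[of _ 0] flip: W_def)
  qed
  obtain \<alpha> where \<alpha>: "A = ennreal \<alpha>" "0 \<le> \<alpha>"
    using int[of 0] by (cases A) (auto simp: real_integrable_def A_def)
  \<comment> \<open>Each truncated mean is \<alpha> minus the finite value of \<open>B N\<close>, so
    the hypothesis bounds all \<open>B N\<close> at once and the bound passes to the supremum. The
    inequality \<open>x \<le> \<alpha>\<close> ensures that \<open>ennreal\<close> does not clip the
    bound to 0.\<close>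
  have "B N \<le> ennreal (\<alpha> - x) \<and> x \<le> \<alpha>" for N
  proof -
    obtain \<beta> where \<beta>: "B N = ennreal \<beta>" "0 \<le> \<beta>"
      using int[of N] by (cases "B N") (auto simp: real_integrable_def B_def)
    have "(\<integral>\<^sup>+t. ennreal (\<phi> N t) \<partial>circle_measure) = A"
      unfolding A_def by (simp flip: pos)
    then have "circle_mean (\<lambda>z. ereal (ln (max (V z) (exp (- real N))))) a r = ereal (\<alpha> - \<beta>)"
      using \<alpha> \<beta> unfolding circle_mean_def ext_integral_def B_def \<phi>_def W_def by simp
    then show ?thesis using le[of N] \<beta> by (auto intro: ennreal_leI)
  qed
  then have "(SUP N. B N) \<le> ennreal (\<alpha> - x)" and "x \<le> \<alpha>"
    by (auto intro: SUP_least)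
  then have "enn2ereal (SUP N. B N) \<le> ereal (\<alpha> - x)"
    by (metis diff_ge_0_iff_ge enn2ereal_ennreal less_eq_ennreal.rep_eq)
  then show ?thesis
    using \<alpha> unfolding mean by (cases "enn2ereal (SUP N. B N)") auto
qed

text \<open>The quotient may vanish on the circle, so its logarithm is first truncated at
  \<open>- N\<close> to give a continuous real majorant; letting \<open>N\<close> grow recovers the
  logarithm.\<close>

lemma log_sum_norm_le_circle_mean:
  fixes g :: "'i \<Rightarrow> complex \<Rightarrow> complex"
  assumes g: "\<And>i. i \<in> I \<Longrightarrow> g i holomorphic_on D"
    and h: "h holomorphic_on D" "\<And>z. z \<in> D \<Longrightarrow> h z \<noteq> 0"
    and D: "cball a r \<subseteq> D" "0 < r"
  shows "log_ereal ((\<Sum>i\<in>I. (cmod (g i a))\<^sup>2) / cmod (h a))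
         \<le> circle_mean (\<lambda>z. log_ereal ((\<Sum>i\<in>I. (cmod (g i z))\<^sup>2) / cmod (h z))) a r"
    (is "log_ereal (?V a) \<le> _")
proof (cases "?V a \<le> 0")
  case True
  then show ?thesis by (simp add: log_ereal_def)
next
  case False
  have sub: "sphere a r \<subseteq> D" using D by auto
  have contV: "continuous_on (sphere a r) ?V"
  proof (intro continuous_intros)
    show "continuous_on (sphere a r) (g i)" if "i \<in> I" for i
      using g[OF that] sub by (meson continuous_on_subset holomorphic_on_imp_continuous_on)
    show "continuous_on (sphere a r) h"
      using h(1) sub by (meson continuous_on_subset holomorphic_on_imp_continuous_on)
  qed (use h sub in auto)
  have "ereal (ln (?V a)) \<le> circle_mean (\<lambda>z. log_ereal (?V z)) a r"
  proof (rule le_circle_mean_log_ereal[OF contV])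
    fix N :: nat
    let ?\<phi> = "\<lambda>z. ln (max (?V z) (exp (- real N)))"
    have cont: "continuous_on (sphere a r) ?\<phi>"
      by (intro continuous_intros contV) (auto simp: max_def not_le)
    have "?V a \<le> exp (integral\<^sup>L circle_measure (\<lambda>t. ?\<phi> (a + of_real r * cis t)))"
    proof (rule sub_mean_value_exp[OF g h D cont])
      fix z
      have "0 < max (?V z) (exp (- real N))" by (simp add: less_max_iff_disj)
      then show "?V z \<le> exp (?\<phi> z)" by simp
    qed
    then have "ln (?V a) \<le> integral\<^sup>L circle_measure (\<lambda>t. ?\<phi> (a + of_real r * cis t))"
      using False by (subst ln_le_iff_le_exp) auto
    then show "ereal (ln (?V a)) \<le> circle_mean (\<lambda>z. ereal (?\<phi> z)) a r"
      using circle_mean_ereal[OF cont] D(2) by simp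
  qed (use D in auto)
  then show ?thesis using False by (simp add: log_ereal_def)
qed

subsection \<open>Upper semicontinuity and maximality\<close>

lemma usc_on_continuous: "continuous_on U u \<Longrightarrow> usc_on U u"
  unfolding usc_on_def
  using continuous_openin_preimage_gen[of U u "{..<c}" for c]
  by (auto simp: vimage_def Int_def)

lemma usc_on_minus_continuous:
  assumes v: "usc_on U v" and \<psi>: "continuous_on U \<psi>"
  shows "usc_on U (\<lambda>z. v z - ereal (\<psi> z))"
  unfolding usc_on_def
proof
  fix c
  show "openin (top_of_set U) {z \<in> U. v z - ereal (\<psi> z) < c}"
  proof (subst openin_subopen, clarify)
    fix z assume z: "z \<in> U" "v z - ereal (\<psi> z) < c"
    obtain c1 where c1: "v z - ereal (\<psi> z) < ereal c1" "ereal c1 < c"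
      using ereal_dense2[OF z(2)] by blast
    have "v z < ereal (c1 + \<psi> z)"
      using c1(1) by (cases "v z") auto
    \<comment> \<open>An intermediate \<open>d\<close> separates the two functions: \<open>v\<close>
      is kept below \<open>d\<close> and \<psi> above \<open>d - c1\<close>, each an open
      condition.\<close>
    then obtain d where d: "v z < ereal d" "d < c1 + \<psi> z"
      using ereal_dense2 by (metis ereal_less_eq(3) not_le)
    have "openin (top_of_set U) {y \<in> U. v y < ereal d}"
      using v by (auto simp: usc_on_def)
    moreover have "openin (top_of_set U) (U \<inter> \<psi> -` {d - c1<..})"
      by (rule continuous_openin_preimage_gen[OF \<psi>]) simp
    ultimately have "openin (top_of_set U) ({y \<in> U. v y < ereal d} \<inter> (U \<inter> \<psi> -` {d - c1<..}))"
      by (rule openin_Int)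
    moreover have "v y - ereal (\<psi> y) < c" if "v y < ereal d" "d - c1 < \<psi> y" for y
    proof -
      have "v y - ereal (\<psi> y) < ereal c1" using that by (cases "v y") auto
      then show ?thesis using c1(2) by (rule less_trans)
    qed
    ultimately show "\<exists>T. openin (top_of_set U) T \<and> z \<in> T \<and> T \<subseteq> {z \<in> U. v z - ereal (\<psi> z) < c}"
      using z d by (intro exI[of _ "{y \<in> U. v y < ereal d} \<inter> (U \<inter> \<psi> -` {d - c1<..})"]) auto
  qed
qed

text \<open>Without a maximum the open sets where \<open>u\<close> lies below \<open>u y\<close>,
  for \<open>y\<close> in \<open>C\<close>, would cover \<open>C\<close>; in a finite subcover the
  index \<open>y\<close> with the largest \<open>u y\<close> is left uncovered.\<close>

lemma usc_on_attains_max: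
  assumes u: "usc_on U u" and C: "compact C" "C \<noteq> {}" "C \<subseteq> U"
  obtains p where "p \<in> C" "\<And>z. z \<in> C \<Longrightarrow> u z \<le> u p"
proof (rule ccontr)
  assume "\<not> thesis"
  then have no: "\<exists>y\<in>C. u z < u y" if "z \<in> C" for z
    using that \<open>\<not> thesis\<close> \<open>\<And>p. \<lbrakk>p \<in> C; \<And>z. z \<in> C \<Longrightarrow> u z \<le> u p\<rbrakk> \<Longrightarrow> thesis\<close> by (meson not_le)
  have "\<forall>y. \<exists>T. open T \<and> {z \<in> U. u z < u y} = U \<inter> T"
    using u by (auto simp: usc_on_def openin_open)
  then obtain T where T: "\<And>y. open (T y)" "\<And>y. {z \<in> U. u z < u y} = U \<inter> T y"
    by metis
  have "C \<subseteq> (\<Union>y\<in>C. T y)" using no T(2) C(3) by blast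
  then obtain Y where Y: "Y \<subseteq> C" "finite Y" "C \<subseteq> (\<Union>y\<in>Y. T y)"
    using compactE_image[OF C(1)] T(1) by metis
  have "Y \<noteq> {}" using Y(3) C(2) by auto
  then obtain y where y: "y \<in> Y" "\<And>y'. y' \<in> Y \<Longrightarrow> u y' \<le> u y"
    using Max_in[of "u ` Y"] Max_ge[of "u ` Y"] Y(2)
    by (metis (no_types, lifting) finite_imageI image_iff image_is_empty)
  obtain y' where "y' \<in> Y" "y \<in> T y'" using Y y(1) by blast
  then have "u y < u y'" using T(2)[of y'] Y(1) y(1) C(3) by blast
  with y(2)[OF \<open>y' \<in> Y\<close>] show False by simp
qed

section \<open>Maximality tested on discs\<close>

lemma bounded_linear_scale_left: "bounded_linear (\<lambda>\<zeta>. \<zeta> *s b)" for b :: "complex ^ 'n"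
  by (intro linear_conv_bounded_linear[THEN iffD1] linearI) (auto simp: vec_eq_iff algebra_simps)

lemma norm_power2_vec: "(norm z)\<^sup>2 = (\<Sum>i\<in>UNIV. (norm (z $ i))\<^sup>2)" for z :: "'a::real_normed_vector ^ 'n"
  by (simp add: norm_vec_def L2_set_def sum_nonneg)

lemma norm_power2_add_scale:
  fixes p b :: "complex ^ 'n"
  shows "(norm (p + \<zeta> *s b))\<^sup>2
    = (norm p)\<^sup>2 + 2 * Re (\<zeta> * (\<Sum>i\<in>UNIV. b $ i * cnj (p $ i))) + (cmod \<zeta>)\<^sup>2 * (norm b)\<^sup>2"
proof -
  have "(cmod (x + \<zeta> * y))\<^sup>2 = (cmod x)\<^sup>2 + 2 * Re (\<zeta> * (y * cnj x)) + (cmod \<zeta>)\<^sup>2 * (cmod y)\<^sup>2" for x y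
    unfolding cmod_power2 by (simp add: power2_eq_square algebra_simps)
  then show ?thesis
    by (simp add: norm_power2_vec sum.distrib sum_distrib_left)
qed

text \<open>The hypothesis \<open>disc\<close> replaces a null direction of the Levi form: along
  some complex line \<sigma> is dominated, up to \<open>o(|\<zeta>|^2)\<close>, by a harmonic
  function with the same value at \<open>p\<close>. No second derivatives of \<sigma> enter.\<close>

lemma maximal_onI_discs:
  fixes \<rho> :: "complex ^ 'n \<Rightarrow> ereal" and \<sigma> :: "complex ^ 'n \<Rightarrow> real"
  assumes \<sigma>: "continuous_on U \<sigma>" "\<And>z. z \<in> U \<Longrightarrow> \<rho> z = ereal (\<sigma> z)"
    and disc: "\<And>p. p \<in> U \<Longrightarrow> \<exists>b \<delta> \<Phi>. b \<noteq> 0 \<and> \<delta> > 0 \<and> \<Phi> holomorphic_on ball 0 \<delta> \<and> Re (\<Phi> 0) = \<sigma> p \<and>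
       (\<forall>\<eta>>0. \<forall>\<^sub>F \<zeta> in at 0. \<sigma> (p + \<zeta> *s b) \<le> Re (\<Phi> \<zeta>) + \<eta> * (cmod \<zeta>)\<^sup>2)"
  shows "maximal_on U \<rho>"
  unfolding maximal_on_def
proof (intro allI impI ballI, elim conjE)
  fix G v z0
  assume G: "open G" "rel_compact_in G U" and v: "psh_on U v"
    and bd: "\<forall>z\<in>frontier G. v z \<le> \<rho> z" and z0: "z0 \<in> G"
  have C: "compact (closure G)" "closure G \<subseteq> U"
    using G(2) by (auto simp: rel_compact_in_def)
  have GC: "G \<subseteq> closure G" by (rule closure_subset)
  show "v z0 \<le> \<rho> z0"
  proof (rule ccontr)
    assume contra: "\<not> v z0 \<le> \<rho> z0"
    have z0U: "z0 \<in> U" using z0 GC C by auto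
    have "v z0 < \<infinity>" using v z0U by (auto simp: psh_on_def)
    with contra \<sigma>(2)[OF z0U] obtain m0 where m0: "v z0 = ereal m0" "\<sigma> z0 < m0"
      by (cases "v z0") auto
    obtain R where R: "\<And>z. z \<in> closure G \<Longrightarrow> norm z \<le> R"
      using compact_imp_bounded[OF C(1)] by (auto simp: bounded_iff)
    \<comment> \<open>So small that adding \<open>\<epsilon> * (norm z)\<^sup>2\<close> on the
      closure of \<open>G\<close> cannot offset the gap \<open>m0 - \<sigma> z0\<close>; hence the
      maximum found below is not on the frontier. The added 1 keeps the denominator
      positive.\<close>
    define \<epsilon> where "\<epsilon> = (m0 - \<sigma> z0) / (R\<^sup>2 + 1)"
    have R1: "R\<^sup>2 + 1 > 0" by (simp add: add_nonneg_pos)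
    have \<epsilon>: "\<epsilon> > 0" using m0(2) R1 by (simp add: \<epsilon>_def)
    have "\<epsilon> * R\<^sup>2 < \<epsilon> * (R\<^sup>2 + 1)" using \<epsilon> by simp
    also have "\<dots> = m0 - \<sigma> z0" using R1 by (simp add: \<epsilon>_def)
    finally have \<epsilon>R: "\<epsilon> * R\<^sup>2 < m0 - \<sigma> z0" .
    define \<psi> where "\<psi> z = \<sigma> z - \<epsilon> * (norm z)\<^sup>2" for z
    have "continuous_on U \<psi>"
      unfolding \<psi>_def by (intro continuous_intros \<sigma>(1))
    then have "usc_on U (\<lambda>z. v z - ereal (\<psi> z))"
      using v by (intro usc_on_minus_continuous) (auto simp: psh_on_def)
    then obtain p where p: "p \<in> closure G"
      and max: "\<And>z. z \<in> closure G \<Longrightarrow> v z - ereal (\<psi> z) \<le> v p - ereal (\<psi> p)"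
      using usc_on_attains_max[of U _ "closure G"] C z0 GC by blast
    have pU: "p \<in> U" using p C by auto
    have "v p < \<infinity>" using v pU by (auto simp: psh_on_def)
    moreover have "v p \<noteq> -\<infinity>"
      using max[of z0] z0 GC m0(1) by (cases "v p") auto
    ultimately obtain m where m: "v p = ereal m" by (cases "v p") auto
    have le: "v z \<le> ereal (\<psi> z + (m - \<psi> p))" if "z \<in> closure G" for z
      using max[OF that] m by (cases "v z") auto
    have pG: "p \<in> G"
    proof (rule ccontr)
      assume "p \<notin> G"
      then have "p \<in> frontier G" using p G(1) by (simp add: frontier_def interior_open)
      then have "m \<le> \<sigma> p" using bd m \<sigma>(2)[OF pU] by force
      moreover have "m0 \<le> \<psi> z0 + (m - \<psi> p)" using le[of z0] m0 z0 GC by auto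
      moreover have "\<epsilon> * (norm p)\<^sup>2 \<le> \<epsilon> * R\<^sup>2"
        using R[OF p] \<epsilon> by (intro mult_left_mono power_mono) auto
      moreover have "0 \<le> \<epsilon> * (norm z0)\<^sup>2" using \<epsilon> by simp
      ultimately show False using \<epsilon>R by (simp add: \<psi>_def)
    qed
    obtain b \<delta> \<Phi> where b: "b \<noteq> 0" and \<delta>: "\<delta> > 0" and \<Phi>: "\<Phi> holomorphic_on ball 0 \<delta>"
      and \<Phi>0: "Re (\<Phi> 0) = \<sigma> p"
      and near: "\<And>\<eta>. \<eta> > 0 \<Longrightarrow> \<forall>\<^sub>F \<zeta> in at 0. \<sigma> (p + \<zeta> *s b) \<le> Re (\<Phi> \<zeta>) + \<eta> * (cmod \<zeta>)\<^sup>2"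
      using disc[OF pU] by blast
    \<comment> \<open>Half of the quadratic gain \<epsilon> \<open>* (norm b)\<^sup>2\<close>: this
      much is lost to the error of the disc, and the other half gives the contradiction.\<close>
    define \<eta> where "\<eta> = \<epsilon> * (norm b)\<^sup>2 / 2"
    have \<eta>: "\<eta> > 0" using \<epsilon> b by (simp add: \<eta>_def)
    obtain r1 where r1: "r1 > 0"
      "\<And>\<zeta>. \<zeta> \<noteq> 0 \<Longrightarrow> dist \<zeta> 0 < r1 \<Longrightarrow> \<sigma> (p + \<zeta> *s b) \<le> Re (\<Phi> \<zeta>) + \<eta> * (cmod \<zeta>)\<^sup>2"
      using near[OF \<eta>] unfolding eventually_at by auto
    have "open ((\<lambda>\<zeta>. p + \<zeta> *s b) -` G)"
      by (intro open_vimage G(1) continuous_intros linear_continuous_on bounded_linear_scale_left)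
    moreover have "0 \<in> (\<lambda>\<zeta>. p + \<zeta> *s b) -` G" using pG by simp
    ultimately obtain r2 where r2: "r2 > 0" "ball 0 r2 \<subseteq> (\<lambda>\<zeta>. p + \<zeta> *s b) -` G"
      by (rule openE)
    then have r2G: "p + \<zeta> *s b \<in> G" if "cmod \<zeta> < r2" for \<zeta>
      using that by auto
    define r where "r = min \<delta> (min r1 r2) / 2"
    have r: "r > 0" "r < \<delta>" "r < r1" "r < r2" using \<delta> r1 r2 by (auto simp: r_def)
    define c where "c = (\<Sum>i\<in>UNIV. b $ i * cnj (p $ i))"
    \<comment> \<open>On the circle of radius \<open>r\<close> the quadratic terms are constant and
      add up to \<open>- 2 * \<eta> * r\<^sup>2 + \<eta> * r\<^sup>2\<close>. What remains is the
      real part of a holomorphic function, whose mean is its value at 0, namely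
      \<open>m - \<eta> * r\<^sup>2\<close>.\<close>
    define \<Psi> where "\<Psi> \<zeta> = \<Phi> \<zeta> - of_real (2 * \<epsilon>) * c * \<zeta> + of_real (m - \<sigma> p - \<eta> * r\<^sup>2)" for \<zeta>
    have \<Psi>: "\<Psi> holomorphic_on ball 0 \<delta>"
      unfolding \<Psi>_def by (intro holomorphic_intros \<Phi>)
    have "cball 0 r \<subseteq> {\<zeta>. p + \<zeta> *s b \<in> U}"
      using r2G r GC C by (auto simp: subset_iff)
    moreover have "subharmonic_on {\<zeta>. p + \<zeta> *s b \<in> U} (\<lambda>\<zeta>. v (p + \<zeta> *s b))"
      using v unfolding psh_on_def by blast
    ultimately have "v (p + 0 *s b) \<le> circle_mean (\<lambda>\<zeta>. v (p + \<zeta> *s b)) 0 r"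
      using r(1) unfolding subharmonic_on_def by blast
    also have "\<dots> \<le> circle_mean (\<lambda>\<zeta>. ereal (Re (\<Psi> \<zeta>))) 0 r"
    proof (rule circle_mean_mono)
      fix \<zeta> :: complex assume "\<zeta> \<in> sphere 0 r"
      then have \<zeta>: "cmod \<zeta> = r" by simp
      then have "p + \<zeta> *s b \<in> G" using r2G[of \<zeta>] r by simp
      then have "v (p + \<zeta> *s b) \<le> ereal (\<psi> (p + \<zeta> *s b) + (m - \<psi> p))"
        using GC by (intro le) auto
      also have "\<psi> (p + \<zeta> *s b) + (m - \<psi> p) \<le> Re (\<Psi> \<zeta>)"
      proof -
        have "\<sigma> (p + \<zeta> *s b) \<le> Re (\<Phi> \<zeta>) + \<eta> * r\<^sup>2"
          using r1(2)[of \<zeta>] \<zeta> r by force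
        moreover have "\<epsilon> * (norm (p + \<zeta> *s b))\<^sup>2
            = \<epsilon> * (norm p)\<^sup>2 + 2 * \<epsilon> * Re (c * \<zeta>) + 2 * (\<eta> * r\<^sup>2)"
          unfolding norm_power2_add_scale \<zeta> c_def[symmetric]
          by (simp add: \<eta>_def field_simps)
        moreover have "Re (\<Psi> \<zeta>) = Re (\<Phi> \<zeta>) - 2 * \<epsilon> * Re (c * \<zeta>) + (m - \<sigma> p - \<eta> * r\<^sup>2)"
          by (simp add: \<Psi>_def mult.assoc del: of_real_mult)
        ultimately show ?thesis by (simp add: \<psi>_def)
      qed
      finally show "v (p + \<zeta> *s b) \<le> ereal (Re (\<Psi> \<zeta>))" by simp
    qed (use r in auto)
    also have "\<dots> = ereal (Re (\<Psi> 0))"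
    proof -
      have \<Psi>c: "continuous_on (cball 0 r) \<Psi>"
        using \<Psi> r by (intro holomorphic_on_imp_continuous_on holomorphic_on_subset[OF \<Psi>]) auto
      have "\<Psi> holomorphic_on ball 0 r"
        using \<Psi> r by (intro holomorphic_on_subset[OF \<Psi>]) auto
      moreover have "continuous_on (sphere 0 r) (\<lambda>\<zeta>. Re (\<Psi> \<zeta>))"
        by (intro continuous_intros continuous_on_subset[OF \<Psi>c]) auto
      ultimately show ?thesis
        using mean_value_circle[OF \<Psi>c] circle_mean_ereal[of 0 r "\<lambda>\<zeta>. Re (\<Psi> \<zeta>)"] r by simp
    qed
    also have "Re (\<Psi> 0) = m - \<eta> * r\<^sup>2"
      using \<Phi>0 by (simp add: \<Psi>_def)
    finally have "m \<le> m - \<eta> * r\<^sup>2" using m by simp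
    then show False using \<eta> r(1) by (simp add: mult_le_0_iff)
  qed
qed

subsection \<open>Holomorphic functions of several variables\<close>

lemma holo_on_const: "holo_on (\<lambda>z. c) U"
  unfolding holo_on_def by (intro ballI exI[of _ "\<lambda>v. 0"]) auto

lemma holo_on_coord: "holo_on (\<lambda>z. z $ i) U"
  unfolding holo_on_def
  by (intro ballI exI[of _ "\<lambda>v. v $ i"])
     (auto intro!: bounded_linear_imp_has_derivative bounded_linear_vec_nth)

lemma holo_on_add:
  assumes "holo_on f U" "holo_on g U"
  shows "holo_on (\<lambda>z. f z + g z) U"
  unfolding holo_on_def
proof
  fix z assume "z \<in> U"
  then obtain f' g' where "(f has_derivative f') (at z)" "\<forall>c v. f' (c *s v) = c * f' v"
    "(g has_derivative g') (at z)" "\<forall>c v. g' (c *s v) = c * g' v"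
    using assms unfolding holo_on_def by meson
  then show "\<exists>h'. ((\<lambda>z. f z + g z) has_derivative h') (at z) \<and> (\<forall>c v. h' (c *s v) = c * h' v)"
    by (intro exI[of _ "\<lambda>v. f' v + g' v"]) (auto intro!: derivative_intros simp: algebra_simps)
qed

lemma holo_on_mult:
  assumes "holo_on f U" "holo_on g U"
  shows "holo_on (\<lambda>z. f z * g z) U"
  unfolding holo_on_def
proof
  fix z assume "z \<in> U"
  then obtain f' g' where "(f has_derivative f') (at z)" "\<forall>c v. f' (c *s v) = c * f' v"
    "(g has_derivative g') (at z)" "\<forall>c v. g' (c *s v) = c * g' v"
    using assms unfolding holo_on_def by meson
  then show "\<exists>h'. ((\<lambda>z. f z * g z) has_derivative h') (at z) \<and> (\<forall>c v. h' (c *s v) = c * h' v)"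
    by (intro exI[of _ "\<lambda>v. f z * g' v + f' v * g z"])
       (auto intro!: derivative_eq_intros simp: algebra_simps)
qed

lemma holo_on_power: "holo_on f U \<Longrightarrow> holo_on (\<lambda>z. f z ^ m) U"
  by (induction m) (auto intro: holo_on_const holo_on_mult)

lemma holo_on_sum:
  "(\<And>j. j \<in> J \<Longrightarrow> holo_on (f j) U) \<Longrightarrow> holo_on (\<lambda>z. \<Sum>j\<in>J. f j z) U"
  by (induction J rule: infinite_finite_induct) (auto intro: holo_on_const holo_on_add)

lemma holo_on_inverse:
  assumes "holo_on f U" "\<And>z. z \<in> U \<Longrightarrow> f z \<noteq> 0"
  shows "holo_on (\<lambda>z. inverse (f z)) U"
  unfolding holo_on_def
proof
  fix z assume z: "z \<in> U"
  then obtain f' where "(f has_derivative f') (at z)" "\<forall>c v. f' (c *s v) = c * f' v"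
    using assms unfolding holo_on_def by meson
  then have "((\<lambda>z. inverse (f z)) has_derivative (\<lambda>v. - (inverse (f z) * f' v * inverse (f z)))) (at z)"
    and "\<forall>c v. - (inverse (f z) * f' (c *s v) * inverse (f z)) = c * - (inverse (f z) * f' v * inverse (f z))"
    using Deriv.has_derivative_inverse[where f = f and x = z] assms(2)[OF z] by simp_all
  then show "\<exists>h'. ((\<lambda>z. inverse (f z)) has_derivative h') (at z) \<and> (\<forall>c v. h' (c *s v) = c * h' v)"
    by (intro exI conjI)
qed

lemma holo_on_subset: "holo_on f U \<Longrightarrow> V \<subseteq> U \<Longrightarrow> holo_on f V"
  by (auto simp: holo_on_def)

lemma holo_on_imp_continuous_on: "holo_on f U \<Longrightarrow> continuous_on U f"
  unfolding holo_on_def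
  by (meson continuous_at_imp_continuous_on has_derivative_continuous)

text \<open>Complex homogeneity makes the real derivative along the line a multiplication by the
  number \<open>f' b\<close>.\<close>

lemma has_field_derivative_along_line:
  fixes b :: "complex ^ 'n"
  assumes "(f has_derivative f') (at (a + \<zeta> *s b))" "\<And>c v. f' (c *s v) = c * f' v"
  shows "((\<lambda>\<zeta>. f (a + \<zeta> *s b)) has_field_derivative f' b) (at \<zeta>)"
proof -
  have "((\<lambda>\<zeta>. a + \<zeta> *s b) has_derivative (\<lambda>h. h *s b)) (at \<zeta>)"
    using has_derivative_add[OF has_derivative_const
        bounded_linear_imp_has_derivative[OF bounded_linear_scale_left[of b]]] by simp
  from has_derivative_compose[OF this assms(1)] show ?thesis
    by (simp add: has_field_derivative_def assms(2) mult_commute_abs)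
qed

lemma holo_on_imp_holomorphic_on_line:
  assumes "holo_on f UNIV"
  shows "(\<lambda>\<zeta>. f (a + \<zeta> *s b)) holomorphic_on S"
  unfolding holomorphic_on_def
proof
  fix \<zeta>
  obtain f' where "(f has_derivative f') (at (a + \<zeta> *s b))" "\<And>c v. f' (c *s v) = c * f' v"
    using assms unfolding holo_on_def by blast
  from has_field_derivative_along_line[OF this]
  show "(\<lambda>\<zeta>. f (a + \<zeta> *s b)) field_differentiable at \<zeta> within S"
    by (metis field_differentiable_at_within field_differentiable_def)
qed

lemma bounded_componentwise:
  fixes S :: "('a::real_normed_vector ^ 'n) set"
  assumes "\<And>z i. z \<in> S \<Longrightarrow> norm (z $ i) \<le> B"
  shows "bounded S"
proof -
  have "norm z \<le> real CARD('n) * B" if "z \<in> S" for z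
  proof -
    have "norm z \<le> (\<Sum>i\<in>UNIV. norm (z $ i))"
      by (simp add: norm_vec_def L2_set_le_sum)
    also have "\<dots> \<le> real CARD('n) * B"
      using assms[OF that] by (intro sum_bounded_above) auto
    finally show ?thesis .
  qed
  then show ?thesis by (auto simp: bounded_iff)
qed

section \<open>The Stein property\<close>

text \<open>The coordinate functions keep the hull bounded and \<open>1 / F\<close> keeps it away
  from the zeros of \<open>F\<close>, so it is closed in the whole space. The coordinates also
  separate points.\<close>

lemma stein_nonzero_set:
  fixes F :: "complex ^ 'n \<Rightarrow> complex"
  assumes F: "holo_on F UNIV"
  shows "stein {z. F z \<noteq> 0}"
proof -
  let ?X = "{z. F z \<noteq> 0}"
  have contF: "continuous_on UNIV F" using F by (rule holo_on_imp_continuous_on)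
  have "compact (holo_hull ?X K)" if K: "compact K" "K \<subseteq> ?X" for K
  proof -
    have bound: "\<exists>M. \<forall>w\<in>K. cmod (f w) \<le> M" if "holo_on f ?X" for f
    proof -
      have "compact (f ` K)"
        using holo_on_imp_continuous_on[OF that] K by (meson compact_continuous_image continuous_on_subset)
      then have "bounded (f ` K)" by (rule compact_imp_bounded)
      then show ?thesis by (auto simp: bounded_iff)
    qed
    have inv: "holo_on (\<lambda>z. inverse (F z)) ?X"
      using F by (intro holo_on_inverse) (auto intro: holo_on_subset)
    then obtain M0 where M0: "\<And>w. w \<in> K \<Longrightarrow> cmod (inverse (F w)) \<le> M0" using bound by blast
    \<comment> \<open>For empty \<open>K\<close> the bound \<open>M0\<close> carries no information
      on its sign; the maximum with 1 is positive in every case.\<close>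
    define M where "M = max M0 1"
    have M: "M > 0" "\<And>w. w \<in> K \<Longrightarrow> cmod (inverse (F w)) \<le> M"
      using M0 by (auto simp: M_def intro: max.coboundedI1)
    have "\<forall>i. \<exists>B. \<forall>w\<in>K. cmod (w $ i) \<le> B" using bound[OF holo_on_coord] by blast
    then obtain B where B: "\<And>i w. w \<in> K \<Longrightarrow> cmod (w $ i) \<le> B i" by metis
    have "cmod (z $ i) \<le> Max (range B)" if "z \<in> holo_hull ?X K" for z i
    proof -
      have "cmod (z $ i) \<le> B i"
        using that B holo_on_coord[of i ?X] unfolding holo_hull_def by blast
      also have "\<dots> \<le> Max (range B)" by simp
      finally show ?thesis .
    qed
    then have bdd: "bounded (holo_hull ?X K)" by (rule bounded_componentwise)
    have low: "1 / M \<le> cmod (F z)" if "z \<in> holo_hull ?X K" for z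
    proof -
      have "F z \<noteq> 0" "cmod (inverse (F z)) \<le> M"
        using that M(2) inv unfolding holo_hull_def by blast+
      then show ?thesis using M(1) by (simp add: norm_divide inverse_eq_divide field_simps)
    qed
    have "closed (holo_hull ?X K)"
      unfolding closed_sequential_limits
    proof (intro allI impI, elim conjE)
      fix x z assume x: "\<forall>n::nat. x n \<in> holo_hull ?X K" "x \<longlonglongrightarrow> z"
      have "(\<lambda>n. cmod (F (x n))) \<longlonglongrightarrow> cmod (F z)"
        using x(2) contF by (intro tendsto_norm) (auto intro: continuous_on_tendsto_compose)
      then have "1 / M \<le> cmod (F z)"
        by (rule LIMSEQ_le_const) (use low x in auto)
      \<comment> \<open>The lower bound on \<open>F\<close> survives in the limit, so
        \<open>z\<close> stays in the domain, and only then are the test functions known to be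
        continuous at \<open>z\<close>.\<close>
      then have zX: "z \<in> ?X" using M(1) by auto
      have "cmod (f z) \<le> N" if f: "holo_on f ?X" "\<forall>w\<in>K. cmod (f w) \<le> N" for f N
      proof -
        have "(\<lambda>n. cmod (f (x n))) \<longlonglongrightarrow> cmod (f z)"
          using x by (intro tendsto_norm continuous_on_tendsto_compose[OF holo_on_imp_continuous_on[OF f(1)] _ zX])
            (auto simp: holo_hull_def)
        then show ?thesis
          by (rule LIMSEQ_le_const2) (use f x in \<open>auto simp: holo_hull_def\<close>)
      qed
      then show "z \<in> holo_hull ?X K" using zX by (auto simp: holo_hull_def)
    qed
    with bdd show ?thesis by (simp add: compact_eq_bounded_closed)
  qed
  moreover have "open ?X"
    using contF by (intro open_Collect_neq continuous_on_const) auto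
  moreover have "\<exists>f. holo_on f ?X \<and> f z \<noteq> f w" if "z \<noteq> w" for z w
  proof -
    obtain i where "z $ i \<noteq> w $ i" using \<open>z \<noteq> w\<close> by (auto simp: vec_eq_iff)
    then show ?thesis using holo_on_coord[of i ?X] by (intro exI[of _ "\<lambda>z. z $ i"]) auto
  qed
  ultimately show ?thesis by (auto simp: stein_def)
qed

section \<open>Properness of the map formed by \<open>F\<close> and the other coordinates\<close>

text \<open>Cauchy's bound for roots: the coefficients are bounded while the other coordinates stay
  bounded, so a large \<open>z $ l\<close> makes the leading power dominate.\<close>

lemma weierstrass_polynomial_proper:
  fixes f :: "nat \<Rightarrow> complex ^ 'n \<Rightarrow> complex"
  assumes k: "k \<ge> 1" and f: "\<And>j. j \<in> {1..k} \<Longrightarrow> continuous_on UNIV (f j)"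
    and indep: "\<And>j. j \<in> {1..k} \<Longrightarrow> independent_of_coord (f j) l"
  shows "bounded {z. (\<forall>i. i \<noteq> l \<longrightarrow> cmod (z $ i) \<le> R) \<and>
           cmod ((z $ l) ^ k + (\<Sum>j=1..k. f j z * (z $ l) ^ (k - j))) \<le> R}"
proof -
  define D where "D = {z :: complex ^ 'n. \<forall>i. cmod (z $ i) \<le> R}"
  have "closed D"
    unfolding D_def by (intro closed_Collect_all closed_Collect_le continuous_intros)
  moreover have "bounded D"
    by (rule bounded_componentwise[of _ R]) (simp add: D_def)
  ultimately have "compact D" by (simp add: compact_eq_bounded_closed)
  moreover have "continuous_on D (\<lambda>z. \<Sum>j=1..k. cmod (f j z))"
    by (intro continuous_intros continuous_on_subset[OF f]) auto
  ultimately have "bounded ((\<lambda>z. \<Sum>j=1..k. cmod (f j z)) ` D)"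
    by (intro compact_imp_bounded compact_continuous_image)
  then obtain B where B: "\<And>z. z \<in> D \<Longrightarrow> (\<Sum>j=1..k. cmod (f j z)) \<le> B"
    unfolding bounded_iff by (auto simp: abs_le_iff)
  show ?thesis
  proof (rule bounded_componentwise)
    fix z i
    assume "z \<in> {z. (\<forall>i. i \<noteq> l \<longrightarrow> cmod (z $ i) \<le> R) \<and>
           cmod ((z $ l) ^ k + (\<Sum>j=1..k. f j z * (z $ l) ^ (k - j))) \<le> R}"
    then have z: "\<And>i. i \<noteq> l \<Longrightarrow> cmod (z $ i) \<le> R"
      and Fz: "cmod ((z $ l) ^ k + (\<Sum>j=1..k. f j z * (z $ l) ^ (k - j))) \<le> R" by auto
    define t where "t = cmod (z $ l)"
    have R: "R \<ge> 0" using Fz norm_ge_zero order_trans by blast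
    \<comment> \<open>Clearing coordinate \<open>l\<close> moves the point into the compact set
      \<open>D\<close> without changing the coefficients.\<close>
    define z' where "z' = (\<chi> i. if i = l then 0 else z $ i)"
    have "z' \<in> D" using z R by (auto simp: D_def z'_def)
    moreover have "f j z = f j z'" if "j \<in> {1..k}" for j
      using indep[OF that] unfolding independent_of_coord_def by (simp add: z'_def)
    ultimately have fB: "(\<Sum>j=1..k. cmod (f j z)) \<le> B" using B by simp
    \<comment> \<open>For \<open>t > 1\<close> every lower power of \<open>t\<close> is at most
      \<open>t ^ (k - 1)\<close>, and so is 1; dividing the estimate by this power leaves
      \<open>t \<le> R + B\<close>.\<close>
    have "t \<le> max 1 (R + B)"
    proof (cases "t \<le> 1")
      case False
      have tk: "t ^ (k - 1) \<ge> 1" using False by (intro one_le_power) simp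
      have "cmod (\<Sum>j=1..k. f j z * (z $ l) ^ (k - j)) \<le> (\<Sum>j=1..k. cmod (f j z) * t ^ (k - 1))"
      proof (rule sum_norm_le)
        fix j assume "j \<in> {1..k}"
        then have "t ^ (k - j) \<le> t ^ (k - 1)" using False by (intro power_increasing) auto
        then show "cmod (f j z * (z $ l) ^ (k - j)) \<le> cmod (f j z) * t ^ (k - 1)"
          by (simp add: norm_mult norm_power t_def mult_left_mono)
      qed
      also have "\<dots> = (\<Sum>j=1..k. cmod (f j z)) * t ^ (k - 1)" by (simp add: sum_distrib_right)
      also have "\<dots> \<le> B * t ^ (k - 1)" using fB tk by (intro mult_right_mono) auto
      finally have "cmod (\<Sum>j=1..k. f j z * (z $ l) ^ (k - j)) \<le> B * t ^ (k - 1)" .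
      moreover have "cmod ((z $ l) ^ k) \<le>
          cmod ((z $ l) ^ k + (\<Sum>j=1..k. f j z * (z $ l) ^ (k - j)))
          + cmod (\<Sum>j=1..k. f j z * (z $ l) ^ (k - j))"
        using norm_triangle_ineq4[of "(z $ l) ^ k + (\<Sum>j=1..k. f j z * (z $ l) ^ (k - j))"
            "\<Sum>j=1..k. f j z * (z $ l) ^ (k - j)"] by simp
      moreover have "R \<le> R * t ^ (k - 1)" using R tk by (simp add: mult_le_cancel_left1)
      moreover have "cmod ((z $ l) ^ k) = t * t ^ (k - 1)"
        using k by (cases k) (simp_all add: norm_power norm_mult t_def)
      ultimately have "t * t ^ (k - 1) \<le> (R + B) * t ^ (k - 1)" using Fz by (simp add: distrib_right)
      then have "t \<le> R + B" using tk by (intro mult_right_le_imp_le[of t "t ^ (k - 1)"]) auto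
      then show ?thesis by simp
    qed auto
    then show "cmod (z $ i) \<le> max R (max 1 (R + B))"
      using z[of i] by (cases "i = l") (auto simp: t_def)
  qed
qed

subsection \<open>The exhaustion function\<close>

text \<open>Of the polynomial form of \<open>F\<close> only this is retained: \<open>F\<close> is
  entire, and together with the coordinates other than \<open>l\<close> it forms a proper
  map.\<close>

locale proper_with_coordinates =
  fixes F :: "complex ^ 'n \<Rightarrow> complex" and l :: 'n
  assumes holo: "holo_on F UNIV"
    and proper: "\<And>R. bounded {z. (\<forall>i. i \<noteq> l \<longrightarrow> cmod (z $ i) \<le> R) \<and> cmod (F z) \<le> R}"
begin

text \<open>The shift to \<open>F z - 1\<close> moves the common zeros of the \<open>g i\<close> off
  the zero set of \<open>F\<close>, so that \<open>V\<close> blows up there.\<close>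

definition g :: "'n \<Rightarrow> complex ^ 'n \<Rightarrow> complex" where
  "g i z = (if i = l then F z - 1 else z $ i)"

text \<open>The numerator is quadratic in \<open>F\<close> and the denominator linear, so
  \<open>V\<close> also tends to infinity as \<open>F\<close> does.\<close>

definition V :: "complex ^ 'n \<Rightarrow> real" where
  "V z = (\<Sum>i\<in>UNIV. (cmod (g i z))\<^sup>2) / cmod (F z)"

definition core :: "(complex ^ 'n) set" where
  "core = {z. \<forall>i. g i z = 0}"

lemma continuous_F: "continuous_on S F"
  using holo_on_imp_continuous_on[OF holo] by (rule continuous_on_subset) simp

lemma continuous_g: "continuous_on S (g i)"
  unfolding g_def by (cases "i = l") (auto intro!: continuous_intros continuous_F)

lemma holo_g: "holo_on (g i) UNIV"
  using holo_on_add[OF holo holo_on_const[of "-1"]] holo_on_coord[of i UNIV]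
  by (cases "i = l") (auto simp: g_def[abs_def])

lemma continuous_V: "continuous_on {z. F z \<noteq> 0} V"
  unfolding V_def by (intro continuous_intros continuous_F continuous_g) auto

lemma sum_g_pos: "z \<notin> core \<Longrightarrow> 0 < (\<Sum>i\<in>UNIV. (cmod (g i z))\<^sup>2)"
  unfolding core_def by (auto intro!: sum_pos2)

lemma V_pos: "F z \<noteq> 0 \<Longrightarrow> z \<notin> core \<Longrightarrow> 0 < V z"
  unfolding V_def using sum_g_pos by simp

lemma continuous_log_V: "continuous_on {z. F z \<noteq> 0} (\<lambda>z. log_ereal (V z))"
  by (rule continuous_on_compose2[OF continuous_on_log_ereal continuous_V]) simp

lemma compact_core_subset: "compact core" "core \<subseteq> {z. F z \<noteq> 0}"
proof -
  have F1: "F z = 1" and z0: "i \<noteq> l \<Longrightarrow> z $ i = 0" if "z \<in> core" for z i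
    using that unfolding core_def g_def by (auto dest: spec[of _ l] spec[of _ i])
  have "closed core"
    unfolding core_def
    by (intro closed_Collect_all closed_Collect_eq continuous_g continuous_on_const)
  moreover have "bounded core"
    by (rule bounded_subset[OF proper[of 1]]) (use F1 z0 in auto)
  ultimately show "compact core" by (simp add: compact_eq_bounded_closed)
  show "core \<subseteq> {z. F z \<noteq> 0}" using F1 by auto
qed

text \<open>Otherwise \<open>F\<close> would take only the values 0 and 1, and the whole
  \<open>l\<close>-axis would lie in a set that is bounded by properness. This is what keeps the
  exhaustion function from being identically \<open>-\<infinity>\<close>.\<close>

lemma exists_outside_core: "\<exists>z. F z \<noteq> 0 \<and> z \<notin> core"
proof (rule ccontr)
  assume no: "\<not> ?thesis"
  obtain R where R: "\<And>z. (\<forall>i. i \<noteq> l \<longrightarrow> cmod (z $ i) \<le> 1) \<Longrightarrow> cmod (F z) \<le> 1 \<Longrightarrow> norm z \<le> R"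
    using proper[of 1] unfolding bounded_iff by blast
  define z :: "complex ^ 'n" where "z = axis l (of_real (\<bar>R\<bar> + 1))"
  have z: "z $ i = 0" if "i \<noteq> l" for i using that by (simp add: z_def axis_def)
  have "F z = 0 \<or> F z = 1"
    using no by (auto simp: core_def g_def split: if_splits)
  then have "norm z \<le> R" using z by (intro R) auto
  moreover have "\<bar>R\<bar> + 1 \<le> norm z"
    using Finite_Cartesian_Product.norm_nth_le[of z l] by (simp add: z_def axis_def)
  ultimately show False by linarith
qed

section \<open>Plurisubharmonicity and exhaustion\<close>

lemma psh_log_V: "psh_on {z. F z \<noteq> 0} (\<lambda>z. log_ereal (V z))"
  unfolding psh_on_def
proof (intro conjI allI)
  obtain z where "F z \<noteq> 0" "z \<notin> core" using exists_outside_core by blast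
  then show "\<exists>z\<in>{z. F z \<noteq> 0}. log_ereal (V z) \<noteq> -\<infinity>"
    using V_pos by (intro bexI[of _ z]) (auto simp: log_ereal_eq_MInf_iff not_le)
  show "usc_on {z. F z \<noteq> 0} (\<lambda>z. log_ereal (V z))"
    by (rule usc_on_continuous[OF continuous_log_V])
  fix a b :: "complex ^ 'n"
  let ?D = "{\<zeta>. a + \<zeta> *s b \<in> {z. F z \<noteq> 0}}"
  show "subharmonic_on ?D (\<lambda>\<zeta>. log_ereal (V (a + \<zeta> *s b)))"
    unfolding subharmonic_on_def
  proof (intro conjI allI impI)
    show "usc_on ?D (\<lambda>\<zeta>. log_ereal (V (a + \<zeta> *s b)))"
      by (intro usc_on_continuous continuous_on_compose2[OF continuous_log_V]
            continuous_intros linear_continuous_on bounded_linear_scale_left) auto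
  next
    fix c r assume "0 < r \<and> cball c r \<subseteq> ?D"
    then show "log_ereal (V (a + c *s b)) \<le> circle_mean (\<lambda>\<zeta>. log_ereal (V (a + \<zeta> *s b))) c r"
      unfolding V_def
      by (intro log_sum_norm_le_circle_mean[of UNIV "\<lambda>i \<zeta>. g i (a + \<zeta> *s b)" ?D "\<lambda>\<zeta>. F (a + \<zeta> *s b)"])
         (auto intro: holo_on_imp_holomorphic_on_line holo_g holo)
  qed auto
qed auto

lemma exhaustion_log_V: "exhaustion_on {z. F z \<noteq> 0} (\<lambda>z. log_ereal (V z))"
  unfolding exhaustion_on_def
proof
  fix C :: real
  \<comment> \<open>Clearing the denominator gives a condition that is closed in the whole space; no
    zero of \<open>F\<close> satisfies it, so it describes the sublevel set exactly.\<close>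
  define E where "E = {z. (\<Sum>i\<in>UNIV. (cmod (g i z))\<^sup>2) \<le> exp C * cmod (F z)}"
  have nz: "F z \<noteq> 0" if "z \<in> E" for z
  proof
    assume "F z = 0"
    then have "cmod (g l z) = 1" by (simp add: g_def)
    then have "z \<notin> core" unfolding core_def by force
    from sum_g_pos[OF this] that \<open>F z = 0\<close> show False by (simp add: E_def)
  qed
  have eq: "{z \<in> {z. F z \<noteq> 0}. log_ereal (V z) \<le> ereal C} = E"
    using nz by (auto simp: E_def V_def log_ereal_le_iff field_simps)
  have "closed E"
    unfolding E_def by (intro closed_Collect_le continuous_intros continuous_g continuous_F)
  moreover have "bounded E"
  proof -
    \<comment> \<open>From \<open>(|F| - 1)^2 \<le> exp C * |F|\<close>, dropping the 1 and dividing
      by \<open>|F|\<close> gives \<open>|F| \<le> exp C + 2\<close>.\<close>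
    define R where "R = exp C + 2"
    have "cmod (F z) \<le> R \<and> (\<forall>i. i \<noteq> l \<longrightarrow> cmod (z $ i) \<le> R)" if z: "z \<in> E" for z
    proof -
      have le: "(cmod (g i z))\<^sup>2 \<le> exp C * cmod (F z)" for i
        using z member_le_sum[of i UNIV "\<lambda>i. (cmod (g i z))\<^sup>2"] by (auto simp: E_def)
      have "\<bar>cmod (F z) - 1\<bar> \<le> \<bar>cmod (F z - 1)\<bar>"
        using norm_triangle_ineq3[of "F z" 1] by simp
      then have "(cmod (F z) - 1)\<^sup>2 \<le> (cmod (F z - 1))\<^sup>2"
        by (simp only: abs_le_square_iff)
      then have "(cmod (F z))\<^sup>2 - 2 * cmod (F z) \<le> (cmod (F z - 1))\<^sup>2"
        by (simp add: power2_diff)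
      also have "\<dots> \<le> exp C * cmod (F z)" using le[of l] by (simp add: g_def)
      finally have "cmod (F z) * cmod (F z) \<le> cmod (F z) * R"
        by (simp add: R_def power2_eq_square algebra_simps)
      then have FR: "cmod (F z) \<le> R" using nz[OF z] by simp
      moreover have "cmod (z $ i) \<le> R" if "i \<noteq> l" for i
      proof (rule power2_le_imp_le)
        have "(cmod (z $ i))\<^sup>2 \<le> exp C * cmod (F z)" using le[of i] that by (simp add: g_def)
        also have "\<dots> \<le> R * R" using FR by (intro mult_mono) (auto simp: R_def)
        finally show "(cmod (z $ i))\<^sup>2 \<le> R\<^sup>2" by (simp add: power2_eq_square)
      qed (simp add: R_def add_nonneg_nonneg)
      ultimately show ?thesis by blast
    qed
    then show ?thesis by (intro bounded_subset[OF proper[of R]]) auto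
  qed
  ultimately have "compact E" by (simp add: compact_eq_bounded_closed)
  then show "rel_compact_in {z \<in> {z. F z \<noteq> 0}. log_ereal (V z) \<le> ereal C} {z. F z \<noteq> 0}"
    unfolding eq rel_compact_in_def using nz \<open>closed E\<close> by auto
qed

section \<open>Null directions and maximality\<close>

text \<open>The direction \<open>b\<close> is tangent to the fibre through \<open>p\<close> of the map to projective space
  with homogeneous coordinates \<open>g i\<close>.\<close>

lemma exists_null_direction:
  assumes "p \<notin> core" and F': "\<And>c v. F' (c *s v) = c * F' v" "\<And>u v. F' (u + v) = F' u + F' v"
  obtains b \<mu> where "b \<noteq> 0" "\<And>i. i \<noteq> l \<Longrightarrow> b $ i = \<mu> * p $ i" "F' b = \<mu> * (F p - 1)"
proof -
  define e :: "complex ^ 'n" where "e = axis l 1"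
  have e: "e $ l = 1" "\<And>i. i \<noteq> l \<Longrightarrow> e $ i = 0" by (auto simp: e_def axis_def)
  show ?thesis
  proof (cases "F' e = 0")
    case True
    \<comment> \<open>Here all \<open>g i\<close> are stationary in the axis direction
      \<open>e\<close>, which serves as \<open>b\<close> with factor 0.\<close>
    show ?thesis
      by (rule that[of e 0]) (use e True in auto)
  next
    case False
    define w :: "complex ^ 'n" where "w = (\<chi> i. if i = l then 0 else p $ i)"
    \<comment> \<open>The multiple of \<open>e\<close> is chosen so that \<open>F' b\<close> becomes
      \<open>F p - 1\<close>, giving the factor 1. If \<open>b\<close> were 0, all
      \<open>g i\<close> would vanish at \<open>p\<close>, contrary to \<open>p\<close> lying
      outside \<open>core\<close>.\<close>
    define b where "b = w + ((F p - 1 - F' w) / F' e) *s e"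
    have b: "b $ i = p $ i" if "i \<noteq> l" for i
      using that e by (simp add: b_def w_def)
    have F'b: "F' b = F p - 1" using False by (simp add: b_def F')
    have "b \<noteq> 0"
    proof
      assume "b = 0"
      moreover have "F' 0 = 0" using F'(1)[of 0 0] by simp
      ultimately have "g i p = 0" for i
        using b F'b by (auto simp: g_def)
      with assms(1) show False by (simp add: core_def)
    qed
    then show ?thesis using b F'b by (intro that[of b 1]) auto
  qed
qed

text \<open>Along \<open>p + \<zeta> b\<close> the coordinates \<open>g i\<close> with \<open>i \<noteq> l\<close> are \<open>(1 + \<mu> \<zeta>) g i p\<close>, and the
  last one is \<open>(1 + \<mu> \<zeta>) q \<zeta>\<close> where \<open>q\<close> has vanishing derivative at 0. So \<open>ln V\<close> is the sum of the harmonic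
  function \<open>ln \<bar>(1 + \<mu> \<zeta>)\<^sup>2 / F\<bar>\<close> and of \<open>ln (c + \<bar>q\<bar>\<^sup>2)\<close>, which is harmonic up to
  \<open>\<bar>q - q 0\<bar>\<^sup>2\<close>.\<close>

lemma null_disc:
  assumes p: "F p \<noteq> 0" "p \<notin> core"
  shows "\<exists>b \<delta> \<Phi>. b \<noteq> 0 \<and> \<delta> > 0 \<and> \<Phi> holomorphic_on ball 0 \<delta> \<and> Re (\<Phi> 0) = ln (V p) \<and>
       (\<forall>\<eta>>0. \<forall>\<^sub>F \<zeta> in at 0. ln (V (p + \<zeta> *s b)) \<le> Re (\<Phi> \<zeta>) + \<eta> * (cmod \<zeta>)\<^sup>2)"
proof -
  obtain F' where F': "(F has_derivative F') (at p)" "\<And>c v. F' (c *s v) = c * F' v"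
    using holo unfolding holo_on_def by blast
  obtain b \<mu> where b: "b \<noteq> 0" "\<And>i. i \<noteq> l \<Longrightarrow> b $ i = \<mu> * p $ i" "F' b = \<mu> * (F p - 1)"
    using exists_null_direction[OF p(2) F'(2)] has_derivative_bounded_linear[OF F'(1)]
    by (metis linear_add bounded_linear.linear)
  define f where "f \<zeta> = F (p + \<zeta> *s b)" for \<zeta>
  define e where "e \<zeta> = 1 + \<mu> * \<zeta>" for \<zeta>
  have f: "f holomorphic_on S" for S
    unfolding f_def by (rule holo_on_imp_holomorphic_on_line[OF holo])
  have e: "e holomorphic_on S" for S
    unfolding e_def by (intro holomorphic_intros)
  have f': "(f has_field_derivative F' b) (at 0)"
    unfolding f_def by (rule has_field_derivative_along_line) (use F' in auto)
  have f0: "f 0 = F p" and e0: "e 0 = 1" by (auto simp: f_def e_def)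
  have "open {\<zeta>. f \<zeta> * e \<zeta> \<noteq> 0}"
    using f[of UNIV] e[of UNIV]
    by (intro open_Collect_neq continuous_intros) (auto intro: holomorphic_on_imp_continuous_on)
  moreover have "0 \<in> {\<zeta>. f \<zeta> * e \<zeta> \<noteq> 0}" using p f0 e0 by simp
  ultimately obtain \<delta> where \<delta>: "\<delta> > 0" "ball 0 \<delta> \<subseteq> {\<zeta>. f \<zeta> * e \<zeta> \<noteq> 0}" by (rule openE)
  have nz: "f \<zeta> \<noteq> 0" "e \<zeta> \<noteq> 0" if "\<zeta> \<in> ball 0 \<delta>" for \<zeta>
    using \<delta>(2) that by auto
  define q where "q \<zeta> = (f \<zeta> - 1) / e \<zeta>" for \<zeta>
  have q: "q holomorphic_on ball 0 \<delta>"
    unfolding q_def using nz by (intro holomorphic_intros f e) auto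
  define w where "w = F p - 1"
  have q0: "q 0 = w" by (simp add: q_def w_def f0 e0)
  have "(e has_field_derivative \<mu>) (at 0)"
    unfolding e_def by (auto intro!: derivative_eq_intros)
  then have "(q has_field_derivative ((F' b - 0) * e 0 - (f 0 - 1) * \<mu>) / (e 0 * e 0)) (at 0)"
    unfolding q_def using e0 by (intro DERIV_divide DERIV_diff f' DERIV_const) auto
  \<comment> \<open>The numerator of the quotient rule is \<open>F' b - (F p - 1) * \<mu>\<close>,
    which vanishes by the choice of \<open>b\<close>.\<close>
  then have q': "(q has_field_derivative 0) (at 0)"
    by (simp add: b(3) f0 e0)
  have "(\<lambda>\<zeta>. (e \<zeta>)\<^sup>2 / f \<zeta>) holomorphic_on ball 0 \<delta>"
    using nz by (intro holomorphic_intros f e) auto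
  \<comment> \<open>A zero-free holomorphic function on a disc has a holomorphic logarithm, so the
    harmonic summand of \<open>ln V\<close> is \<open>Re H\<close>.\<close>
  then obtain H where H: "H holomorphic_on ball 0 \<delta>"
    "\<And>\<zeta>. \<zeta> \<in> ball 0 \<delta> \<Longrightarrow> (e \<zeta>)\<^sup>2 / f \<zeta> = exp (H \<zeta>)"
    using contractible_imp_holomorphic_log[of _ "ball 0 \<delta>"] nz convex_imp_contractible[OF convex_ball]
    by (metis (no_types, lifting) divide_eq_0_iff power_eq_0_iff)
  define c where "c = (\<Sum>i\<in>UNIV - {l}. (cmod (p $ i))\<^sup>2)"
  define s where "s = c + (cmod w)\<^sup>2"
  have sum_split: "(\<Sum>i\<in>UNIV. (cmod (g i z))\<^sup>2)
      = (\<Sum>i\<in>UNIV - {l}. (cmod (z $ i))\<^sup>2) + (cmod (F z - 1))\<^sup>2" for z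
    by (subst sum.remove[of _ l]) (auto simp: g_def)
  have s: "s > 0" using sum_g_pos[OF p(2)] by (simp add: sum_split s_def c_def w_def)
  have V_line: "V (p + \<zeta> *s b) = exp (Re (H \<zeta>)) * (c + (cmod (q \<zeta>))\<^sup>2)" if \<zeta>: "\<zeta> \<in> ball 0 \<delta>" for \<zeta>
  proof -
    have "(\<Sum>i\<in>UNIV - {l}. (cmod ((p + \<zeta> *s b) $ i))\<^sup>2) = (cmod (e \<zeta>))\<^sup>2 * c"
      unfolding c_def sum_distrib_left
    proof (rule sum.cong)
      fix i assume "i \<in> UNIV - {l}"
      then have "(p + \<zeta> *s b) $ i = e \<zeta> * p $ i"
        by (simp add: b(2) e_def algebra_simps)
      then show "(cmod ((p + \<zeta> *s b) $ i))\<^sup>2 = (cmod (e \<zeta>))\<^sup>2 * (cmod (p $ i))\<^sup>2"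
        by (simp add: norm_mult power_mult_distrib)
    qed simp
    moreover have "cmod (F (p + \<zeta> *s b) - 1) = cmod (e \<zeta>) * cmod (q \<zeta>)"
      using nz[OF \<zeta>] by (simp add: q_def f_def flip: norm_mult)
    ultimately have "V (p + \<zeta> *s b) = (cmod (e \<zeta>))\<^sup>2 / cmod (f \<zeta>) * (c + (cmod (q \<zeta>))\<^sup>2)"
      by (simp add: V_def sum_split f_def power_mult_distrib algebra_simps)
    also have "(cmod (e \<zeta>))\<^sup>2 / cmod (f \<zeta>) = cmod (exp (H \<zeta>))"
      using H(2)[OF \<zeta>] by (metis norm_divide norm_power)
    finally show ?thesis by (simp add: norm_exp_eq_Re)
  qed
  \<comment> \<open>Besides \<open>H\<close> this contains the tangent-line bound of
    \<open>ln\<close> at \<open>s\<close>, applied to the part of \<open>c + |q|^2\<close> that is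
    linear in \<open>q - w\<close> and hence the real part of a holomorphic function.\<close>
  define \<Phi> where "\<Phi> \<zeta> = H \<zeta> + of_real (ln s) + of_real (2 / s) * (cnj w * (q \<zeta> - w))" for \<zeta>
  have "\<Phi> holomorphic_on ball 0 \<delta>"
    unfolding \<Phi>_def by (intro holomorphic_intros H q)
  moreover have "Re (\<Phi> 0) = ln (V p)"
    using V_line[of 0] \<delta>(1) s q0 by (simp add: \<Phi>_def ln_mult s_def)
  moreover have "\<forall>\<^sub>F \<zeta> in at 0. ln (V (p + \<zeta> *s b)) \<le> Re (\<Phi> \<zeta>) + \<eta> * (cmod \<zeta>)\<^sup>2" if \<eta>: "\<eta> > 0" for \<eta>
  proof -
    have "((\<lambda>\<zeta>. (q \<zeta> - w) / \<zeta>) \<longlongrightarrow> 0) (at 0)"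
      using q' q0 by (simp add: DERIV_def)
    then have "\<forall>\<^sub>F \<zeta> in at 0. dist ((q \<zeta> - w) / \<zeta>) 0 < sqrt (\<eta> * s)"
      by (rule tendstoD) (use \<eta> s in simp)
    moreover have "\<forall>\<^sub>F \<zeta> in at (0::complex). \<zeta> \<noteq> 0"
      by (simp add: eventually_at_filter)
    moreover have "\<forall>\<^sub>F \<zeta> in at 0. \<zeta> \<in> ball 0 \<delta>"
      by (rule eventually_at_in_open') (use \<delta> in auto)
    moreover have "\<forall>\<^sub>F \<zeta> in at 0. 0 < c + (cmod (q \<zeta>))\<^sup>2"
    proof (rule order_tendstoD(1))
      have "(q \<longlongrightarrow> w) (at 0)"
        using DERIV_isCont[OF q'] q0 by (simp add: isCont_def)
      then show "((\<lambda>\<zeta>. c + (cmod (q \<zeta>))\<^sup>2) \<longlongrightarrow> c + (cmod w)\<^sup>2) (at 0)"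
        by (intro tendsto_intros)
    qed (use s in \<open>simp add: s_def\<close>)
    ultimately show ?thesis
    proof eventually_elim
      case (elim \<zeta>)
      let ?x = "c + (cmod (q \<zeta>))\<^sup>2"
      have "cmod (q \<zeta> - w) < sqrt (\<eta> * s) * cmod \<zeta>"
        using elim(1,2) by (simp add: norm_divide field_simps)
      then have "(cmod (q \<zeta> - w))\<^sup>2 \<le> (sqrt (\<eta> * s) * cmod \<zeta>)\<^sup>2"
        by (intro power_mono) auto
      then have small: "(cmod (q \<zeta> - w))\<^sup>2 / s \<le> \<eta> * (cmod \<zeta>)\<^sup>2"
        using \<eta> s by (simp add: power_mult_distrib field_simps)
      have "?x = s + 2 * Re (cnj w * (q \<zeta> - w)) + (cmod (q \<zeta> - w))\<^sup>2"
        unfolding s_def cmod_power2 by (simp add: power2_eq_square algebra_simps)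
      then have frac: "?x / s - 1 = 2 / s * Re (cnj w * (q \<zeta> - w)) + (cmod (q \<zeta> - w))\<^sup>2 / s"
        using s by (simp add: field_simps)
      have "ln (?x / s) \<le> ?x / s - 1"
        using elim(4) s by (intro ln_le_minus_one) simp
      then have "ln ?x \<le> ln s + 2 / s * Re (cnj w * (q \<zeta> - w)) + \<eta> * (cmod \<zeta>)\<^sup>2"
        using elim(4) s frac small by (simp add: ln_div)
      moreover have "ln (V (p + \<zeta> *s b)) = Re (H \<zeta>) + ln ?x"
        using V_line[OF elim(3)] elim(4) by (simp add: ln_mult)
      moreover have "Re (\<Phi> \<zeta>) = Re (H \<zeta>) + ln s + 2 / s * Re (cnj w * (q \<zeta> - w))"
        unfolding \<Phi>_def by (simp only: plus_complex.sel Re_complex_of_real times_complex.sel Im_complex_of_real)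
      ultimately show ?case by linarith
    qed
  qed
  ultimately show ?thesis using b(1) \<delta>(1) by blast
qed

lemma maximal_log_V: "maximal_on ({z. F z \<noteq> 0} - core) (\<lambda>z. log_ereal (V z))"
proof (rule maximal_onI_discs)
  show "continuous_on ({z. F z \<noteq> 0} - core) (\<lambda>z. ln (V z))"
    by (intro continuous_intros continuous_on_subset[OF continuous_V]) (auto dest: V_pos)
next
  fix z assume "z \<in> {z. F z \<noteq> 0} - core"
  then show "log_ereal (V z) = ereal (ln (V z))"
    using V_pos[of z] by (simp add: log_ereal_def)
next
  fix p assume "p \<in> {z. F z \<noteq> 0} - core"
  then show "\<exists>b \<delta> \<Phi>. b \<noteq> 0 \<and> \<delta> > 0 \<and> \<Phi> holomorphic_on ball 0 \<delta> \<and> Re (\<Phi> 0) = ln (V p) \<and>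
       (\<forall>\<eta>>0. \<forall>\<^sub>F \<zeta> in at 0. ln (V (p + \<zeta> *s b)) \<le> Re (\<Phi> \<zeta>) + \<eta> * (cmod \<zeta>)\<^sup>2)"
    using null_disc by simp
qed

lemma S_star_parabolic_nonzero_set: "S_star_parabolic {z. F z \<noteq> 0}"
  unfolding S_star_parabolic_def
  using stein_nonzero_set[OF holo] psh_log_V continuous_log_V exhaustion_log_V compact_core_subset maximal_log_V
  by blast

end

theorem theorem4:
  fixes k :: nat
    and l :: "'n::finite"
    and f :: "nat \<Rightarrow> complex ^ 'n \<Rightarrow> complex"
    and F :: "complex ^ 'n \<Rightarrow> complex"
    and A X :: "(complex ^ 'n) set"
  assumes "k \<ge> 1"
    and "\<And>j. j \<in> {1..k} \<Longrightarrow> holo_on (f j) UNIV"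
    and "\<And>j. j \<in> {1..k} \<Longrightarrow> independent_of_coord (f j) l"
    and "\<And>z. F z = (z $ l) ^ k + (\<Sum>j=1..k. f j z * (z $ l) ^ (k - j))"
    and "A = {z. F z = 0}"
    and "X = - A"
  shows "S_star_parabolic X"
proof -
  have F_eq: "F = (\<lambda>z. (z $ l) ^ k + (\<Sum>j=1..k. f j z * (z $ l) ^ (k - j)))"
    using assms(4) by blast
  interpret proper_with_coordinates F l
  proof
    show "holo_on F UNIV"
      unfolding F_eq
      by (intro holo_on_add holo_on_sum holo_on_mult holo_on_power holo_on_coord assms(2))
    show "bounded {z. (\<forall>i. i \<noteq> l \<longrightarrow> cmod (z $ i) \<le> R) \<and> cmod (F z) \<le> R}" for R
      unfolding F_eq
      by (intro weierstrass_polynomial_proper assms(1,3) holo_on_imp_continuous_on assms(2))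
  qed
  have "X = {z. F z \<noteq> 0}" using assms(5,6) by auto
  then show ?thesis using S_star_parabolic_nonzero_set by simp
qed

end
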